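(* The non-$\Sigma$ dg operad $\underline{\mathcal A}$ describing $A_\infty$-algebras does not admit a co-associative diagonal; that is, there is no diagonal $\Delta:\underline{\mathcal A}\to\underline{\mathcal A}\otimes\underline{\mathcal A}$ such that $(\Delta\otimes \mathrm{id})\circ\Delta=(\mathrm{id}\otimes\Delta)\circ\Delta$. Therefore $\underline{\mathcal A}$ is not a Hopf operad.
   Context: Everything is over a ground field $\mathbf k$. Throughout, "operad" means a non-$\Sigma$ pseudo-operad $\mathcal P=\{\mathcal P(n)\}$ with $\mathcal P(0)=\mathcal P(1)=0$, i.e. with operations $\circ_i:\mathcal P(r)\otimes\mathcal P(s)\to\mathcal P(r+s-1)$, $1\le i\le r$, satisfying the usual associativity axioms (with Koszul signs) but without units; a dg operad is an operad in chain complexes over $\mathbf k$ (differential of degree $-1$). $\underline{\mathcal A}$ is the dg operad which, as a graded operad, is free on generators $c(n)\in\underline{\mathcal A}(n)$ of degree $n-2$, $n\ge2$, with differential the derivation determined by $$\partial c(n)=\sum_{r+s=n+1,\ r,s\ge 2,\ 1\le i\le r}(-1)^{(r+i)s+i}\,c(r)\circ_i c(s).$$ It is the minimal model of the non-$\Sigma$ operad $\mathcal{A}ss$ of associative algebras, where $\mathcal{A}ss(n)=\mathbf k\cdot\mu_n$ for $n\ge2$, concentrated in degree $0$, with $\mu_r\circ_i\mu_s=\mu_{r+s-1}$; one has $H_*(\underline{\mathcal A})\cong\mathcal{A}ss$, the class of $c(2)$ corresponding to $\mu_2$. For dg operads $\mathcal P,\mathcal Q$, the tensor product is $(\mathcal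 P\otimes\mathcal Q)(n)=\mathcal P(n)\otimes\mathcal Q(n)$ with $(a\otimes b)\circ_i(a'\otimes b')=(-1)^{\deg b\,\deg a'}(a\circ_i a')\otimes(b\circ_i b')$. A diagonal on $\underline{\mathcal A}$ is a morphism of dg operads $\Delta:\underline{\mathcal A}\to\underline{\mathcal A}\otimes\underline{\mathcal A}$ which induces on homology the usual diagonal $\Delta_{\mathcal{A}ss}:\mathcal{A}ss\to\mathcal{A}ss\otimes\mathcal{A}ss$, $\mu_n\mapsto\mu_n\otimes\mu_n$. A Hopf operad (in the sense of Getzler and Jones) is an operad in the category of (counital, coassociative) coalgebras: a dg operad $\mathcal P$ with a coassociative morphism of dg operads $\mathcal P\to\mathcal P\otimes\mathcal P$ and a counit for it which is a morphism of dg operads from $\mathcal P$ to the operad having $\mathbf k$ in each arity $n\geq 2$ (the unit for $\otimes$, here $\mathcal{A}ss$). *)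

theory Defs
  imports "HOL.Vector_Spaces" "HOL-Library.Poly_Mapping"
begin

section \<open>Vector spaces with a chosen basis\<close>

text \<open>
  The free vector space on a set of generators of type \<open>'b\<close> over the field \<open>'k\<close> is the type
  \<open>'b \<Rightarrow>\<^sub>0 'k\<close> of finitely supported functions.  Every vector space over a field is of this form,
  and in this form the tensor product of the spaces on \<open>'b\<close> and on \<open>'c\<close> is the space
  on \<open>'b \<times> 'c\<close>.
\<close>

definition scale :: "'k::field \<Rightarrow> ('b \<Rightarrow>\<^sub>0 'k) \<Rightarrow> ('b \<Rightarrow>\<^sub>0 'k)" where
  "scale c v = Poly_Mapping.map ((*) c) v"

abbreviation vec :: "'b \<Rightarrow> ('b \<Rightarrow>\<^sub>0 'k::field)" where
  "vec b \<equiv> Poly_Mapping.single b 1"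

definition lin :: "('b \<Rightarrow> ('c \<Rightarrow>\<^sub>0 'k)) \<Rightarrow> ('b \<Rightarrow>\<^sub>0 'k::field) \<Rightarrow> ('c \<Rightarrow>\<^sub>0 'k)" where
  "lin f v = (\<Sum>b\<in>Poly_Mapping.keys v. scale (Poly_Mapping.lookup v b) (f b))"

definition bilin ::
  "('a \<Rightarrow> 'b \<Rightarrow> ('c \<Rightarrow>\<^sub>0 'k)) \<Rightarrow> ('a \<Rightarrow>\<^sub>0 'k::field) \<Rightarrow> ('b \<Rightarrow>\<^sub>0 'k) \<Rightarrow> ('c \<Rightarrow>\<^sub>0 'k)" where
  "bilin f u v = lin (\<lambda>a. lin (f a) v) u"

definition tens :: "('a \<Rightarrow>\<^sub>0 'k::field) \<Rightarrow> ('b \<Rightarrow>\<^sub>0 'k) \<Rightarrow> ('a \<times> 'b \<Rightarrow>\<^sub>0 'k)" where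
  "tens = bilin (\<lambda>a b. vec (a, b))"

definition ksign :: "int \<Rightarrow> 'k::field" where
  "ksign n = (if even n then 1 else - 1)"

lemma lookup_scale [simp]: "Poly_Mapping.lookup (scale c v) b = c * Poly_Mapping.lookup v b"
  unfolding scale_def by (simp add: map.rep_eq when_def)

interpretation fvs: vector_space "scale :: 'k::field \<Rightarrow> ('b \<Rightarrow>\<^sub>0 'k) \<Rightarrow> _"
  by unfold_locales (auto intro!: poly_mapping_eqI simp: lookup_add algebra_simps)

lemma lin_superset:
  assumes "finite A" "Poly_Mapping.keys v \<subseteq> A"
  shows "lin f v = (\<Sum>b\<in>A. scale (Poly_Mapping.lookup v b) (f b))"
  unfolding lin_def using assms
  by (intro sum.mono_neutral_left) (auto simp: in_keys_iff)

lemma linear_lin: "Vector_Spaces.linear scale scale (lin f)"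
proof -
  have "lin f (u + v) = lin f u + lin f v" for u v
  proof -
    have "lin f w = (\<Sum>b\<in>Poly_Mapping.keys u \<union> Poly_Mapping.keys v. scale (Poly_Mapping.lookup w b) (f b))"
      if "w \<in> {u, v, u + v}" for w
      using that keys_add[of u v] by (intro lin_superset) auto
    then show ?thesis by (simp add: lookup_add fvs.scale_left_distrib sum.distrib)
  qed
  moreover have "lin f (scale c v) = scale c (lin f v)" for c v
  proof -
    have "lin f (scale c v) = (\<Sum>b\<in>Poly_Mapping.keys v. scale (Poly_Mapping.lookup (scale c v) b) (f b))"
      by (intro lin_superset) (auto simp: in_keys_iff)
    then show ?thesis by (simp add: lin_def fvs.scale_sum_right)
  qed
  ultimately show ?thesis
    by (simp add: Vector_Spaces.linear_iff fvs.vector_space_axioms)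
qed

lemma lin_vec [simp]: "lin f (vec b) = f b"
  by (simp add: lin_def)

lemma linear_eq_on_keys:
  assumes "Vector_Spaces.linear scale scale f" "Vector_Spaces.linear scale scale g" "\<And>b. b \<in> Poly_Mapping.keys v \<Longrightarrow> f (vec b) = g (vec b)"
  shows "f v = g v"
proof -
  interpret f: Vector_Spaces.linear scale scale f by fact
  interpret g: Vector_Spaces.linear scale scale g by fact
  have v: "v = (\<Sum>b\<in>Poly_Mapping.keys v. scale (Poly_Mapping.lookup v b) (vec b))"
    by (rule poly_mapping_eqI)
       (auto simp: lookup_sum lookup_single when_def if_distrib sum.delta in_keys_iff cong: if_cong)
  show ?thesis
    by (subst (1 2) v) (simp add: f.sum g.sum f.scale g.scale assms)
qed


section \<open>Dg operads\<close>

text \<open>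
  A family of graded vector spaces \<open>P(n)\<close> is given by a set of basis elements, each with an
  arity \<open>n\<close> and a degree; \<open>homog P n d\<close> is the degree \<open>d\<close> part of \<open>P(n)\<close>.  Operations are stored as
  total functions on the direct sum of all the \<open>P(n)\<close>; only their values on elements of
  \<open>homog P n d\<close>, and \<open>circ P i a b\<close> only for \<open>1 \<le> i \<le> arity of a\<close>, are meaningful.
\<close>

record (overloaded) ('b, 'k::field) dg_data =
  basis :: "'b set"
  arity :: "'b \<Rightarrow> nat"
  deg :: "'b \<Rightarrow> int"
  circ :: "nat \<Rightarrow> ('b \<Rightarrow>\<^sub>0 'k) \<Rightarrow> ('b \<Rightarrow>\<^sub>0 'k) \<Rightarrow> ('b \<Rightarrow>\<^sub>0 'k)"
  bd :: "('b \<Rightarrow>\<^sub>0 'k) \<Rightarrow> ('b \<Rightarrow>\<^sub>0 'k)"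

definition aspace :: "('b, 'k::field) dg_data \<Rightarrow> nat \<Rightarrow> ('b \<Rightarrow>\<^sub>0 'k) set" where
  "aspace P n = {v. \<forall>b\<in>Poly_Mapping.keys v. b \<in> basis P \<and> arity P b = n}"

definition homog :: "('b, 'k::field) dg_data \<Rightarrow> nat \<Rightarrow> int \<Rightarrow> ('b \<Rightarrow>\<^sub>0 'k) set" where
  "homog P n d = {v. \<forall>b\<in>Poly_Mapping.keys v. b \<in> basis P \<and> arity P b = n \<and> deg P b = d}"

locale dg_operad =
  fixes P :: "('b, 'k::field) dg_data"
  assumes arity_ge_2: "x \<in> basis P \<Longrightarrow> 2 \<le> arity P x"
    and circ_linear_left: "Vector_Spaces.linear scale scale (\<lambda>a. circ P i a b)"
    and circ_linear_right: "Vector_Spaces.linear scale scale (\<lambda>b. circ P i a b)"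
    and circ_homog:
      "\<lbrakk>a \<in> homog P r d; b \<in> homog P s e; 1 \<le> i; i \<le> r\<rbrakk>
        \<Longrightarrow> circ P i a b \<in> homog P (r + s - 1) (d + e)"
    and circ_nested:
      "\<lbrakk>a \<in> homog P r d; b \<in> homog P s e; c \<in> homog P t f; 1 \<le> i; i \<le> r; 1 \<le> j; j \<le> s\<rbrakk>
        \<Longrightarrow> circ P (i + j - 1) (circ P i a b) c = circ P i a (circ P j b c)"
    and circ_parallel:
      "\<lbrakk>a \<in> homog P r d; b \<in> homog P s e; c \<in> homog P t f; 1 \<le> i; i < j; j \<le> r\<rbrakk>
        \<Longrightarrow> circ P (j + s - 1) (circ P i a b) c
            = scale (ksign (e * f)) (circ P i (circ P j a c) b)"
    and bd_linear: "Vector_Spaces.linear scale scale (bd P)"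
    and bd_homog: "a \<in> homog P n d \<Longrightarrow> bd P a \<in> homog P n (d - 1)"
    and bd_bd: "a \<in> homog P n d \<Longrightarrow> bd P (bd P a) = 0"
    and bd_circ:
      "\<lbrakk>a \<in> homog P r d; b \<in> homog P s e; 1 \<le> i; i \<le> r\<rbrakk>
        \<Longrightarrow> bd P (circ P i a b)
            = circ P i (bd P a) b + scale (ksign d) (circ P i a (bd P b))"

text \<open>
  A morphism is one linear map on the direct sum of all the \<open>P(n)\<close>, which amounts to a family of
  linear maps \<open>P(n) \<rightarrow> Q(n)\<close>.
\<close>

definition dg_morphism ::
  "('b, 'k::field) dg_data \<Rightarrow> ('c, 'k) dg_data \<Rightarrow> (('b \<Rightarrow>\<^sub>0 'k) \<Rightarrow> ('c \<Rightarrow>\<^sub>0 'k)) \<Rightarrow> bool" where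
  "dg_morphism P Q f \<longleftrightarrow>
     Vector_Spaces.linear scale scale f \<and>
     (\<forall>n d. \<forall>a\<in>homog P n d. f a \<in> homog Q n d \<and> f (bd P a) = bd Q (f a)) \<and>
     (\<forall>r s i. \<forall>a\<in>aspace P r. \<forall>b\<in>aspace P s. 1 \<le> i \<and> i \<le> r \<longrightarrow>
        f (circ P i a b) = circ Q i (f a) (f b))"


section \<open>Tensor products\<close>

definition tensor ::
  "('b, 'k::field) dg_data \<Rightarrow> ('c, 'k) dg_data \<Rightarrow> ('b \<times> 'c, 'k) dg_data" (infixr \<open>\<otimes>\<^sub>o\<close> 70) where
  "P \<otimes>\<^sub>o Q = \<lparr>
     basis = {(a, b). a \<in> basis P \<and> b \<in> basis Q \<and> arity P a = arity Q b},
     arity = (\<lambda>(a, b). arity P a),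
     deg = (\<lambda>(a, b). deg P a + deg Q b),
     circ = (\<lambda>i. bilin (\<lambda>(a, b) (a', b').
       scale (ksign (deg Q b * deg P a'))
         (tens (circ P i (vec a) (vec a')) (circ Q i (vec b) (vec b'))))),
     bd = lin (\<lambda>(a, b).
       tens (bd P (vec a)) (vec b) + scale (ksign (deg P a)) (tens (vec a) (bd Q (vec b))))\<rparr>"

text \<open>The maps tensored below all have degree \<open>0\<close>, so no Koszul sign enters.\<close>

definition tensor_map ::
  "(('a \<Rightarrow>\<^sub>0 'k::field) \<Rightarrow> ('c \<Rightarrow>\<^sub>0 'k)) \<Rightarrow> (('b \<Rightarrow>\<^sub>0 'k) \<Rightarrow> ('d \<Rightarrow>\<^sub>0 'k))
    \<Rightarrow> ('a \<times> 'b \<Rightarrow>\<^sub>0 'k) \<Rightarrow> ('c \<times> 'd \<Rightarrow>\<^sub>0 'k)" where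
  "tensor_map f g = lin (\<lambda>(a, b). tens (f (vec a)) (g (vec b)))"

definition reassoc :: "(('a \<times> 'b) \<times> 'c \<Rightarrow>\<^sub>0 'k::field) \<Rightarrow> ('a \<times> 'b \<times> 'c \<Rightarrow>\<^sub>0 'k)" where
  "reassoc = lin (\<lambda>((a, b), c). vec (a, b, c))"

definition coassociative ::
  "('b, 'k::field) dg_data \<Rightarrow> (('b \<Rightarrow>\<^sub>0 'k) \<Rightarrow> ('b \<times> 'b \<Rightarrow>\<^sub>0 'k)) \<Rightarrow> bool" where
  "coassociative P \<Delta> \<longleftrightarrow>
     (\<forall>n. \<forall>x\<in>aspace P n. reassoc (tensor_map \<Delta> id (\<Delta> x)) = tensor_map id \<Delta> (\<Delta> x))"


section \<open>Homology\<close>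

definition cycles :: "('b, 'k::field) dg_data \<Rightarrow> nat \<Rightarrow> int \<Rightarrow> ('b \<Rightarrow>\<^sub>0 'k) set" where
  "cycles P n d = {x \<in> homog P n d. bd P x = 0}"

definition homologous ::
  "('b, 'k::field) dg_data \<Rightarrow> nat \<Rightarrow> int \<Rightarrow> (('b \<Rightarrow>\<^sub>0 'k) \<times> ('b \<Rightarrow>\<^sub>0 'k)) set" where
  "homologous P n d =
     {(x, y). x \<in> cycles P n d \<and> y \<in> cycles P n d \<and> y - x \<in> bd P ` homog P n (d + 1)}"

definition homology :: "('b, 'k::field) dg_data \<Rightarrow> nat \<Rightarrow> int \<Rightarrow> ('b \<Rightarrow>\<^sub>0 'k) set set" where
  "homology P n d = cycles P n d // homologous P n d"

text \<open>
  The map induced by a chain map \<open>f\<close> into \<open>Q\<close> sends the class of \<open>x\<close> to the class of \<open>f x\<close>.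
\<close>

definition homology_map ::
  "('c, 'k::field) dg_data \<Rightarrow> (('b \<Rightarrow>\<^sub>0 'k) \<Rightarrow> ('c \<Rightarrow>\<^sub>0 'k)) \<Rightarrow> nat \<Rightarrow> int
    \<Rightarrow> ('b \<Rightarrow>\<^sub>0 'k) set \<Rightarrow> ('c \<Rightarrow>\<^sub>0 'k) set" where
  "homology_map Q f n d X = homologous Q n d `` (f ` X)"


section \<open>The operad of associative algebras\<close>

text \<open>The number \<open>n \<ge> 2\<close> stands for the basis element \<open>\<mu>\<^sub>n\<close>.\<close>

definition Ass :: "(nat, 'k::field) dg_data" where
  "Ass = \<lparr>
     basis = {2..},
     arity = (\<lambda>n. n),
     deg = (\<lambda>_. 0),
     circ = (\<lambda>i. bilin (\<lambda>r s. vec (r + s - 1))),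
     bd = (\<lambda>_. 0)\<rparr>"

definition Ass_diag :: "(nat \<Rightarrow>\<^sub>0 'k::field) \<Rightarrow> (nat \<times> nat \<Rightarrow>\<^sub>0 'k)" where
  "Ass_diag = lin (\<lambda>n. vec (n, n))"


section \<open>Hopf operads\<close>

definition counital ::
  "('b, 'k::field) dg_data \<Rightarrow> (('b \<Rightarrow>\<^sub>0 'k) \<Rightarrow> ('b \<times> 'b \<Rightarrow>\<^sub>0 'k)) \<Rightarrow> (('b \<Rightarrow>\<^sub>0 'k) \<Rightarrow> (nat \<Rightarrow>\<^sub>0 'k)) \<Rightarrow> bool"
  where
  "counital P \<Delta> \<epsilon> \<longleftrightarrow>
     (\<forall>n. \<forall>x\<in>aspace P n.
        lin (\<lambda>(m, b). vec b) (tensor_map \<epsilon> id (\<Delta> x)) = x \<and>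
        lin (\<lambda>(b, m). vec b) (tensor_map id \<epsilon> (\<Delta> x)) = x)"

definition hopf_operad :: "('b, 'k::field) dg_data \<Rightarrow> bool" where
  "hopf_operad P \<longleftrightarrow> dg_operad P \<and>
     (\<exists>\<Delta> \<epsilon>. dg_morphism P (P \<otimes>\<^sub>o P) \<Delta> \<and> coassociative P \<Delta> \<and>
            dg_morphism P Ass \<epsilon> \<and> counital P \<Delta> \<epsilon>)"


section \<open>The operad of A-infinity algebras\<close>

text \<open>
  The free operad on generators \<open>c(n)\<close> of degree \<open>n - 2\<close>, \<open>n \<ge> 2\<close>, has as basis the planar trees
  with more than one leaf all of whose vertices have at least two children: a vertex with \<open>n\<close> children
  is a \<open>c(n)\<close>.  A tree denotes the iterated composite of its vertices taken in preorder (root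
  first, then the children from left to right); this fixes its sign.
\<close>

datatype tree = Leaf | Node "tree list"

fun proper :: "tree \<Rightarrow> bool" where
  "proper Leaf = True"
| "proper (Node ts) = (2 \<le> length ts \<and> (\<forall>t\<in>set ts. proper t))"

fun leaves :: "tree \<Rightarrow> nat" and leaves_list :: "tree list \<Rightarrow> nat" where
  "leaves Leaf = 1"
| "leaves (Node ts) = leaves_list ts"
| "leaves_list [] = 0"
| "leaves_list (t # ts) = leaves t + leaves_list ts"

fun tdeg :: "tree \<Rightarrow> int" and tdeg_list :: "tree list \<Rightarrow> int" where
  "tdeg Leaf = 0"
| "tdeg (Node ts) = int (length ts) - 2 + tdeg_list ts"
| "tdeg_list [] = 0"
| "tdeg_list (t # ts) = tdeg t + tdeg_list ts"

text \<open>\<open>graft i S T\<close> replaces the \<open>i\<close>-th leaf of \<open>T\<close> by \<open>S\<close>.\<close>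

fun graft :: "nat \<Rightarrow> tree \<Rightarrow> tree \<Rightarrow> tree"
  and graft_list :: "nat \<Rightarrow> tree \<Rightarrow> tree list \<Rightarrow> tree list" where
  "graft i S Leaf = S"
| "graft i S (Node ts) = Node (graft_list i S ts)"
| "graft_list i S [] = []"
| "graft_list i S (t # ts) =
     (if i \<le> leaves t then graft i S t # ts else t # graft_list (i - leaves t) S ts)"

text \<open>
  The total degree of the vertices of \<open>T\<close> that come after its \<open>i\<close>-th leaf in preorder: the vertices
  past which those of \<open>S\<close> have to be moved in \<open>T \<circ>\<^sub>i S\<close>.
\<close>

fun after :: "nat \<Rightarrow> tree \<Rightarrow> int" and after_list :: "nat \<Rightarrow> tree list \<Rightarrow> int" where
  "after i Leaf = 0"
| "after i (Node ts) = after_list i ts"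
| "after_list i [] = 0"
| "after_list i (t # ts) =
     (if i \<le> leaves t then after i t + tdeg_list ts else after_list (i - leaves t) ts)"

definition tree_circ :: "nat \<Rightarrow> tree \<Rightarrow> tree \<Rightarrow> (tree \<Rightarrow>\<^sub>0 'k::field)" where
  "tree_circ i T S = scale (ksign (tdeg S * after i T)) (vec (graft i S T))"

definition cindices :: "nat \<Rightarrow> (nat \<times> nat \<times> nat) set" where
  "cindices n = {(r, s, i). r + s = n + 1 \<and> 2 \<le> r \<and> 2 \<le> s \<and> 1 \<le> i \<and> i \<le> r}"

text \<open>
  \<open>(c(r) \<circ>\<^sub>i c(s))(t\<^sub>1, \<dots>, t\<^sub>n)\<close> with \<open>n = r + s - 1\<close>, up to the sign that comes from moving \<open>c(s)\<close>,
  of degree \<open>s - 2\<close>, past \<open>t\<^sub>1, \<dots>, t\<^sub>i\<^sub>-\<^sub>1\<close>.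
\<close>

definition face :: "nat \<Rightarrow> nat \<Rightarrow> tree list \<Rightarrow> tree" where
  "face s i ts = Node (take (i - 1) ts @ Node (take s (drop (i - 1) ts)) # drop (i - 1 + s) ts)"

definition node_bd :: "tree list \<Rightarrow> (tree \<Rightarrow>\<^sub>0 'k::field)" where
  "node_bd ts = (\<Sum>(r, s, i)\<in>cindices (length ts).
     scale (ksign (int ((r + i) * s + i)) * ksign ((int s - 2) * tdeg_list (take (i - 1) ts)))
       (vec (face s i ts)))"

text \<open>
  The differential of \<open>c(n)(t\<^sub>1, \<dots>, t\<^sub>n)\<close> by the Leibniz rule; \<open>list_bd\<close> is the differential of the
  list \<open>t\<^sub>1, \<dots>, t\<^sub>n\<close> regarded as the tensor of its entries.  The theorems \<open>dg_operad_Ainf\<close> and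
  \<open>Ainf_bd_cgen\<close> below show that this is the derivation with the prescribed values on the generators;
  freeness is \<open>Ainf_free_existence\<close> and \<open>Ainf_free_uniqueness\<close>.
\<close>

fun tree_bd :: "tree \<Rightarrow> (tree \<Rightarrow>\<^sub>0 'k::field)"
  and list_bd :: "tree list \<Rightarrow> (tree list \<Rightarrow>\<^sub>0 'k::field)" where
  "tree_bd Leaf = 0"
| "tree_bd (Node ts) =
     node_bd ts + scale (ksign (int (length ts) - 2)) (lin (\<lambda>us. vec (Node us)) (list_bd ts))"
| "list_bd [] = 0"
| "list_bd (t # ts) =
     lin (\<lambda>u. vec (u # ts)) (tree_bd t)
     + scale (ksign (tdeg t)) (lin (\<lambda>us. vec (t # us)) (list_bd ts))"

definition Ainf :: "(tree, 'k::field) dg_data" where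
  "Ainf = \<lparr>
     basis = {t. proper t \<and> t \<noteq> Leaf},
     arity = leaves,
     deg = tdeg,
     circ = (\<lambda>i. bilin (tree_circ i)),
     bd = lin tree_bd\<rparr>"

definition cgen :: "nat \<Rightarrow> (tree \<Rightarrow>\<^sub>0 'k::field)" where
  "cgen n = vec (Node (replicate n Leaf))"

text \<open>
  The morphism \<open>Ainf \<rightarrow> Ass\<close> sending \<open>c(2)\<close> to \<open>\<mu>\<^sub>2\<close> and \<open>c(n)\<close> to \<open>0\<close> for \<open>n \<ge> 3\<close> (see
  \<open>dg_morphism_augm\<close> below).  It is a quasi-isomorphism and realises the identification of the
  homology of \<open>Ainf\<close> with \<open>Ass\<close>.
\<close>

definition augm :: "(tree \<Rightarrow>\<^sub>0 'k::field) \<Rightarrow> (nat \<Rightarrow>\<^sub>0 'k)" where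
  "augm = lin (\<lambda>t. if tdeg t = 0 then vec (leaves t) else 0)"

text \<open>
  The square says that the map induced by \<open>\<Delta>\<close> becomes \<open>Ass_diag\<close> under the identifications
  of the homology of \<open>Ainf\<close> with \<open>Ass\<close> and, by the Kuenneth theorem, of that of \<open>Ainf \<otimes>\<^sub>o Ainf\<close>
  with \<open>Ass \<otimes>\<^sub>o Ass\<close>.
\<close>

definition induces_Ass_diag :: "((tree \<Rightarrow>\<^sub>0 'k::field) \<Rightarrow> (tree \<times> tree \<Rightarrow>\<^sub>0 'k)) \<Rightarrow> bool" where
  "induces_Ass_diag \<Delta> \<longleftrightarrow>
     (\<forall>n d. \<forall>X\<in>homology Ainf n d.
        homology_map (Ass \<otimes>\<^sub>o Ass) (tensor_map augm augm) n d
          (homology_map (Ainf \<otimes>\<^sub>o Ainf) \<Delta> n d X)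
        = homology_map (Ass \<otimes>\<^sub>o Ass) Ass_diag n d (homology_map Ass augm n d X))"

definition diagonal :: "((tree \<Rightarrow>\<^sub>0 'k::field) \<Rightarrow> (tree \<times> tree \<Rightarrow>\<^sub>0 'k)) \<Rightarrow> bool" where
  "diagonal \<Delta> \<longleftrightarrow> dg_morphism Ainf (Ainf \<otimes>\<^sub>o Ainf) \<Delta> \<and> induces_Ass_diag \<Delta>"


section \<open>Linear extension\<close>

lemma lin_add: "lin f (u + v) = lin f u + lin f v"
  and lin_scale: "lin f (scale c v) = scale c (lin f v)"
  and lin_zero [simp]: "lin f 0 = 0"
  and lin_diff: "lin f (u - v) = lin f u - lin f v"
  and lin_sum: "lin f (sum g A) = (\<Sum>x\<in>A. lin f (g x))"
proof -
  interpret l: Vector_Spaces.linear scale scale "lin f" by (rule linear_lin)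
  show "lin f (u + v) = lin f u + lin f v" by (rule l.add)
  show "lin f (scale c v) = scale c (lin f v)" by (rule l.scale)
  show "lin f 0 = 0" by (rule l.zero)
  show "lin f (u - v) = lin f u - lin f v" by (rule l.diff)
  show "lin f (sum g A) = (\<Sum>x\<in>A. lin f (g x))" by (rule l.sum)
qed

lemma lin_fun_add: "lin (\<lambda>x. f x + g x) v = lin f v + lin g v"
  by (simp add: lin_def fvs.scale_right_distrib sum.distrib)

lemma lin_fun_scale: "lin (\<lambda>x. scale c (f x)) v = scale c (lin f v)"
  by (simp add: lin_def fvs.scale_sum_right mult.commute)

lemma lin_fun_zero [simp]: "lin (\<lambda>x. 0) v = 0"
  by (simp add: lin_def)

lemma lin_lin: "lin f (lin g v) = lin (\<lambda>x. lin f (g x)) v"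
  by (simp add: lin_def [of g] lin_def [of "\<lambda>x. lin f (g x)"] lin_sum lin_scale)

lemma lin_cong: "(\<And>b. b \<in> Poly_Mapping.keys v \<Longrightarrow> f b = g b) \<Longrightarrow> lin f v = lin g v"
  by (simp add: lin_def)

lemma lin_vec_id [simp]: "lin vec v = v"
  by (rule linear_eq_on_keys) (auto simp: linear_lin fvs.linear_ident)

lemma bilin_vec [simp]: "bilin f (vec a) (vec b) = f a b"
  by (simp add: bilin_def)

lemma linear_bilin_left: "Vector_Spaces.linear scale scale (\<lambda>u. bilin f u v)"
  unfolding bilin_def by (rule linear_lin)

lemma linear_bilin_right: "Vector_Spaces.linear scale scale (bilin f u)"
  by (simp add: Vector_Spaces.linear_iff fvs.vector_space_axioms bilin_def lin_add lin_scale
      lin_fun_add lin_fun_scale)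

lemma ksign_mult: "ksign a * ksign b = (ksign (a + b) :: 'k::field)"
  by (auto simp: ksign_def)

lemma ksign_cong: "even (a - b) \<Longrightarrow> ksign a = (ksign b :: 'k::field)"
  by (auto simp: ksign_def)

lemma scale_ksign_cong: "even (a - b) \<Longrightarrow> scale (ksign a) v = scale (ksign b) v"
  by (metis ksign_cong)

lemma scale_ksign2: "scale (ksign a) (scale (ksign b) v) = scale (ksign (a + b)) v"
  by (simp add: ksign_mult)

lemma keys_vec [simp]: "Poly_Mapping.keys (vec b :: _ \<Rightarrow>\<^sub>0 'k::field) = {b}"
  by simp

lemma keys_scale: "Poly_Mapping.keys (scale c v) \<subseteq> Poly_Mapping.keys v"
  by (auto simp: in_keys_iff)

lemma keys_addD: "b \<in> Poly_Mapping.keys (u + v) \<Longrightarrow>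
    b \<in> Poly_Mapping.keys u \<or> b \<in> Poly_Mapping.keys v"
  using keys_add[of u v] by blast

lemma keys_scaleD: "b \<in> Poly_Mapping.keys (scale c v) \<Longrightarrow> b \<in> Poly_Mapping.keys v"
  using keys_scale[of c v] by blast

lemma keys_sumD: "b \<in> Poly_Mapping.keys (sum f A) \<Longrightarrow> \<exists>a\<in>A. b \<in> Poly_Mapping.keys (f a)"
proof (induction A rule: infinite_finite_induct)
  case (insert x F)
  then show ?case using keys_addD[of b "f x" "sum f F"] by auto
qed auto

lemma keys_linD: "b \<in> Poly_Mapping.keys (lin f v) \<Longrightarrow>
    \<exists>a\<in>Poly_Mapping.keys v. b \<in> Poly_Mapping.keys (f a)"
  unfolding lin_def by (blast dest: keys_sumD keys_scaleD)


lemma leaves_graft: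
  "1 \<le> i \<Longrightarrow> i \<le> leaves T \<Longrightarrow> leaves (graft i S T) + 1 = leaves T + leaves S"
  "1 \<le> i \<Longrightarrow> i \<le> leaves_list ts \<Longrightarrow>
     leaves_list (graft_list i S ts) + 1 = leaves_list ts + leaves S"
  by (induction i S T and i S ts rule: graft_graft_list.induct) auto

lemma length_graft_list [simp]: "length (graft_list i S ts) = length ts"
  by (induction ts arbitrary: i) auto

lemma tdeg_graft:
  "1 \<le> i \<Longrightarrow> i \<le> leaves T \<Longrightarrow> tdeg (graft i S T) = tdeg T + tdeg S"
  "1 \<le> i \<Longrightarrow> i \<le> leaves_list ts \<Longrightarrow> tdeg_list (graft_list i S ts) = tdeg_list ts + tdeg S"
  by (induction i S T and i S ts rule: graft_graft_list.induct) auto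

lemma proper_graft:
  "proper S \<Longrightarrow> proper T \<Longrightarrow> proper (graft i S T)"
  "proper S \<Longrightarrow> \<forall>t\<in>set ts. proper t \<Longrightarrow> \<forall>t\<in>set (graft_list i S ts). proper t"
  by (induction i S T and i S ts rule: graft_graft_list.induct) auto

lemma graft_nested:
  "1 \<le> i \<Longrightarrow> i \<le> leaves T \<Longrightarrow> 1 \<le> j \<Longrightarrow> j \<le> leaves S \<Longrightarrow>
     graft (i + j - 1) U (graft i S T) = graft i (graft j U S) T"
  "1 \<le> i \<Longrightarrow> i \<le> leaves_list ts \<Longrightarrow> 1 \<le> j \<Longrightarrow> j \<le> leaves S \<Longrightarrow>
     graft_list (i + j - 1) U (graft_list i S ts) = graft_list i (graft j U S) ts"
proof (induction i S T and i S ts rule: graft_graft_list.induct)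
  case (4 i S t ts)
  show ?case
  proof (cases "i \<le> leaves t")
    case True
    then have "leaves (graft i S t) + 1 = leaves t + leaves S"
      using 4 leaves_graft(1) by blast
    then have "i + j - Suc 0 \<le> leaves (graft i S t)" using 4 True by linarith
    then show ?thesis using 4 True by simp
  next
    case False
    then have "i + j - Suc (leaves t) = i - leaves t + j - Suc 0" using 4 by linarith
    then show ?thesis using 4 False by auto
  qed
qed auto

lemma after_nested:
  "1 \<le> i \<Longrightarrow> i \<le> leaves T \<Longrightarrow> 1 \<le> j \<Longrightarrow> j \<le> leaves S \<Longrightarrow>
     after (i + j - 1) (graft i S T) = after i T + after j S"
  "1 \<le> i \<Longrightarrow> i \<le> leaves_list ts \<Longrightarrow> 1 \<le> j \<Longrightarrow> j \<le> leaves S \<Longrightarrow>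
     after_list (i + j - 1) (graft_list i S ts) = after_list i ts + after j S"
proof (induction i S T and i S ts rule: graft_graft_list.induct)
  case (4 i S t ts)
  show ?case
  proof (cases "i \<le> leaves t")
    case True
    then have "leaves (graft i S t) + 1 = leaves t + leaves S"
      using 4 leaves_graft(1) by blast
    then have "i + j - Suc 0 \<le> leaves (graft i S t)" using 4 True by linarith
    then show ?thesis using 4 True by simp
  next
    case False
    then have "i + j - Suc (leaves t) = i - leaves t + j - Suc 0" using 4 by linarith
    then show ?thesis using 4 False by auto
  qed
qed auto

lemma graft_parallel:
  "1 \<le> i \<Longrightarrow> i < j \<Longrightarrow> j \<le> leaves T \<Longrightarrow>
     graft (j + leaves S - 1) U (graft i S T) = graft i S (graft j U T) \<and>
     after (j + leaves S - 1) (graft i S T) = after j T \<and>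
     after i (graft j U T) = after i T + tdeg U"
  "1 \<le> i \<Longrightarrow> i < j \<Longrightarrow> j \<le> leaves_list ts \<Longrightarrow>
     graft_list (j + leaves S - 1) U (graft_list i S ts) = graft_list i S (graft_list j U ts) \<and>
     after_list (j + leaves S - 1) (graft_list i S ts) = after_list j ts \<and>
     after_list i (graft_list j U ts) = after_list i ts + tdeg U"
proof (induction i S T and i S ts arbitrary: j and j rule: graft_graft_list.induct)
  case (4 i S t ts)
  consider "j \<le> leaves t" | "i \<le> leaves t" "leaves t < j" | "leaves t < i" by linarith
  then show ?case
  proof cases
    case 1
    then have "leaves (graft i S t) + 1 = leaves t + leaves S"
      "leaves (graft j U t) + 1 = leaves t + leaves U"
      using 4 leaves_graft(1)[of i t S] leaves_graft(1)[of j t U] by auto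
    then show ?thesis using 4(1)[of j] 4(3-) 1 by auto
  next
    case 2
    then have a: "leaves (graft i S t) + 1 = leaves t + leaves S"
      using 4 leaves_graft(1)[of i t S] by auto
    then have "j + leaves S - Suc (leaves (graft i S t)) = j - leaves t"
      "\<not> j + leaves S - Suc 0 \<le> leaves (graft i S t)"
      using 2 by linarith+
    then show ?thesis using 4(3-) 2 a tdeg_graft(2)[of "j - leaves t" ts U]
      by auto
  next
    case 3
    then have "j + leaves S - Suc (leaves t) = j - leaves t + leaves S - Suc 0"
      "\<not> j + leaves S - Suc 0 \<le> leaves t"
      using 4(3-) by linarith+
    then show ?thesis using 4(2)[of "j - leaves t"] 4(3-) 3 by auto
  qed
qed auto


section \<open>Keys of the differential\<close>

lemma leaves_list_append [simp]: "leaves_list (xs @ ys) = leaves_list xs + leaves_list ys"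
  by (induction xs) auto

lemma tdeg_list_append [simp]: "tdeg_list (xs @ ys) = tdeg_list xs + tdeg_list ys"
  by (induction xs) auto

lemma finite_cindices [simp]: "finite (cindices n)"
  by (rule finite_subset[of _ "{..n+1} \<times> {..n+1} \<times> {..n+1}"]) (auto simp: cindices_def)

lemma split3: "ts = take a ts @ take s (drop a ts) @ drop (a + s) ts"
  by (metis append_take_drop_id drop_drop add.commute)

lemma face_split:
  assumes "(r, s, i) \<in> cindices (length ts)"
  obtains p q z where "ts = p @ q @ z" "length p = i - 1" "length q = s" "length z = r - i"
proof (rule that[OF split3[of ts "i - 1" s]])
qed (use assms in \<open>auto simp: cindices_def\<close>)

lemma face_eq:
  "length p = i - 1 \<Longrightarrow> length q = s \<Longrightarrow> face s i (p @ q @ z) = Node (p @ Node q # z)"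
  by (simp add: face_def)

lemma face_props:
  assumes "(r, s, i) \<in> cindices (length ts)"
  shows "leaves (face s i ts) = leaves_list ts" "tdeg (face s i ts) = tdeg (Node ts) - 1"
    "\<forall>t\<in>set ts. proper t \<Longrightarrow> proper (face s i ts)" "face s i ts \<noteq> Leaf"
proof -
  obtain p q z where pqz: "ts = p @ q @ z" "length p = i - 1" "length q = s" "length z = r - i"
    using face_split[OF assms] .
  have c: "r + s = length ts + 1" "2 \<le> r" "2 \<le> s" "1 \<le> i" "i \<le> r"
    using assms by (auto simp: cindices_def)
  have f: "face s i ts = Node (p @ Node q # z)"
    unfolding pqz(1) by (rule face_eq) (use pqz in auto)
  show "leaves (face s i ts) = leaves_list ts" "tdeg (face s i ts) = tdeg (Node ts) - 1"
    "\<forall>t\<in>set ts. proper t \<Longrightarrow> proper (face s i ts)" "face s i ts \<noteq> Leaf"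
    unfolding f using pqz c by (auto simp: f)
qed

lemma keys_node_bd:
  assumes "u \<in> Poly_Mapping.keys (node_bd ts :: tree \<Rightarrow>\<^sub>0 'k::field)"
  shows "\<exists>r s i. (r, s, i) \<in> cindices (length ts) \<and> u = face s i ts"
proof -
  obtain x where x: "x \<in> cindices (length ts)"
    "u \<in> Poly_Mapping.keys (case x of (r, s, i) \<Rightarrow>
       scale (ksign (int ((r + i) * s + i)) * ksign ((int s - 2) * tdeg_list (take (i - 1) ts)) :: 'k)
       (vec (face s i ts)))"
    using keys_sumD[OF assms[unfolded node_bd_def]] by (elim bexE)
  obtain r s i where rsi: "x = (r, s, i)" by (cases x)
  have "u \<in> Poly_Mapping.keys (vec (face s i ts) :: tree \<Rightarrow>\<^sub>0 'k)"
    using x(2) unfolding rsi prod.case by (rule keys_scaleD)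
  then have "u = face s i ts" unfolding keys_vec by (rule singletonD)
  with x(1) show ?thesis unfolding rsi by blast
qed

lemma keys_bd:
  fixes dummy :: "'k::field"
  shows "u \<in> Poly_Mapping.keys (tree_bd t :: tree \<Rightarrow>\<^sub>0 'k) \<Longrightarrow>
    leaves u = leaves t \<and> tdeg u = tdeg t - 1 \<and> (proper t \<longrightarrow> proper u) \<and> u \<noteq> Leaf"
  and "us \<in> Poly_Mapping.keys (list_bd ts :: tree list \<Rightarrow>\<^sub>0 'k) \<Longrightarrow>
    leaves_list us = leaves_list ts \<and> tdeg_list us = tdeg_list ts - 1 \<and> length us = length ts \<and>
    ((\<forall>t\<in>set ts. proper t) \<longrightarrow> (\<forall>t\<in>set us. proper t))"
proof (induction t and ts arbitrary: u and us rule: leaves_leaves_list.induct)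
  case (2 ts)
  note IH = 2(1)
  from 2(2) have "u \<in> Poly_Mapping.keys (node_bd ts :: tree \<Rightarrow>\<^sub>0 'k) \<or>
     u \<in> Poly_Mapping.keys (scale (ksign (int (length ts) - 2)) (lin (\<lambda>us. vec (Node us)) (list_bd ts)) :: _ \<Rightarrow>\<^sub>0 'k)"
    unfolding tree_bd.simps by (rule keys_addD)
  then consider "u \<in> Poly_Mapping.keys (node_bd ts :: tree \<Rightarrow>\<^sub>0 'k)"
    | us where "us \<in> Poly_Mapping.keys (list_bd ts :: tree list \<Rightarrow>\<^sub>0 'k)" "u = Node us"
    by (auto dest!: keys_scaleD keys_linD)
  then show ?case
  proof cases
    case 1
    then obtain r s i where "(r, s, i) \<in> cindices (length ts)" "u = face s i ts"
      using keys_node_bd by blast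
    then show ?thesis using face_props[of r s i ts] by simp
  next
    case (2 us)
    then show ?thesis using IH[OF 2(1)] by simp
  qed
next
  case (4 t ts)
  from 4(3) have "us \<in> Poly_Mapping.keys (lin (\<lambda>u. vec (u # ts)) (tree_bd t) :: _ \<Rightarrow>\<^sub>0 'k) \<or>
     us \<in> Poly_Mapping.keys (scale (ksign (tdeg t)) (lin (\<lambda>us. vec (t # us)) (list_bd ts)) :: _ \<Rightarrow>\<^sub>0 'k)"
    unfolding list_bd.simps by (rule keys_addD)
  then consider v where "v \<in> Poly_Mapping.keys (tree_bd t :: tree \<Rightarrow>\<^sub>0 'k)" "us = v # ts"
    | vs where "vs \<in> Poly_Mapping.keys (list_bd ts :: tree list \<Rightarrow>\<^sub>0 'k)" "us = t # vs"
    by (auto dest!: keys_scaleD keys_linD)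
  then show ?case
  proof cases
    case (1 v)
    then show ?thesis using 4(1)[OF 1(1)] by simp
  next
    case (2 vs)
    then show ?thesis using 4(2)[OF 2(1)] by simp
  qed
next
  case 1
  then show ?case by simp
next
  case 3
  then show ?case by simp
qed


section \<open>Derivation\<close>

definition list_circ :: "nat \<Rightarrow> tree list \<Rightarrow> tree \<Rightarrow> (tree list \<Rightarrow>\<^sub>0 'k::field)" where
  "list_circ i ts S = scale (ksign (tdeg S * after_list i ts)) (vec (graft_list i S ts))"

lemma graft_list_append:
  "1 \<le> i \<Longrightarrow> graft_list i S (xs @ ys) =
    (if i \<le> leaves_list xs then graft_list i S xs @ ys
     else xs @ graft_list (i - leaves_list xs) S ys)"
  by (induction xs arbitrary: i) (auto simp: le_diff_conv)

lemma after_list_append: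
  "1 \<le> i \<Longrightarrow> after_list i (xs @ ys) =
    (if i \<le> leaves_list xs then after_list i xs + tdeg_list ys
     else after_list (i - leaves_list xs) ys)"
  by (induction xs arbitrary: i) (auto simp: le_diff_conv)

lemma node_bd_derivation:
  assumes "1 \<le> i" "i \<le> leaves_list ts"
  shows "scale (ksign (tdeg S * after_list i ts)) (node_bd (graft_list i S ts))
    = lin (\<lambda>T. tree_circ i T S) (node_bd ts :: tree \<Rightarrow>\<^sub>0 'k::field)"
proof -
  have "scale (ksign (tdeg S * after_list i ts))
       (scale (ksign (int ((r + k) * s + k)) *
          ksign ((int s - 2) * tdeg_list (take (k - 1) (graft_list i S ts))))
         (vec (face s k (graft_list i S ts))))
     = scale (ksign (int ((r + k) * s + k)) * ksign ((int s - 2) * tdeg_list (take (k - 1) ts)))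
         (tree_circ i (face s k ts) S :: tree \<Rightarrow>\<^sub>0 'k)"
    if c: "(r, s, k) \<in> cindices (length ts)" for r s k
  proof -
    obtain p q z where pqz: "ts = p @ q @ z" "length p = k - 1" "length q = s" "length z = r - k"
      using face_split[OF c] .
    have t: "take (k - 1) ts = p" using pqz by simp
    have f: "face s k ts = Node (p @ Node q # z)"
      unfolding pqz(1) by (rule face_eq) (use pqz in auto)
    consider (p) "i \<le> leaves_list p"
      | (q) "leaves_list p < i" "i \<le> leaves_list p + leaves_list q"
      | (z) "leaves_list p + leaves_list q < i" by linarith
    then show ?thesis
    proof cases
      case p
      have g: "graft_list i S ts = graft_list i S p @ q @ z"
        using p assms by (simp add: pqz(1) graft_list_append)
      have f': "face s k (graft_list i S ts) = Node (graft_list i S p @ Node q # z)"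
        unfolding g by (rule face_eq) (use pqz in auto)
      have t': "take (k - 1) (graft_list i S ts) = graft_list i S p"
        unfolding g using pqz by simp
      show ?thesis
        unfolding t t' f f' tree_circ_def
        using p assms pqz
        by (simp add: graft_list_append after_list_append tdeg_graft ksign_mult
              del: fvs.scale_cancel_right)
           (rule scale_ksign_cong, simp add: algebra_simps)
    next
      case q
      then have q': "i - leaves_list p \<le> leaves_list q" "1 \<le> i - leaves_list p"
        "\<not> i \<le> leaves_list p" by linarith+
      have g: "graft_list i S ts = p @ graft_list (i - leaves_list p) S q @ z"
        using q' assms by (simp add: pqz(1) graft_list_append)
      have f': "face s k (graft_list i S ts) = Node (p @ Node (graft_list (i - leaves_list p) S q) # z)"
        unfolding g by (rule face_eq) (use pqz in auto)
      have t': "take (k - 1) (graft_list i S ts) = p"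
        unfolding g using pqz by simp
      show ?thesis
        unfolding t t' f f' tree_circ_def
        using q' assms pqz
        by (simp add: graft_list_append after_list_append tdeg_graft ksign_mult
              del: fvs.scale_cancel_right)
           (rule scale_ksign_cong, simp add: algebra_simps)
    next
      case z
      then have z': "\<not> i - leaves_list p \<le> leaves_list q" "1 \<le> i - leaves_list p"
        "\<not> i \<le> leaves_list p" "1 \<le> i - leaves_list p - leaves_list q"
        "i - leaves_list p - leaves_list q \<le> leaves_list z" 
        using assms pqz by auto
      have g: "graft_list i S ts = p @ q @ graft_list (i - leaves_list p - leaves_list q) S z"
        using z' assms by (simp add: pqz(1) graft_list_append)
      have f': "face s k (graft_list i S ts) =
          Node (p @ Node q # graft_list (i - leaves_list p - leaves_list q) S z)"
        unfolding g by (rule face_eq) (use pqz in auto)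
      have t': "take (k - 1) (graft_list i S ts) = p"
        unfolding g using pqz by simp
      show ?thesis
        unfolding t t' f f' tree_circ_def
        using z' assms pqz
        by (simp add: graft_list_append after_list_append tdeg_graft ksign_mult
              del: fvs.scale_cancel_right)
           (rule scale_ksign_cong, simp add: algebra_simps)
    qed
  qed
  then show ?thesis
    unfolding node_bd_def lin_sum fvs.scale_sum_right length_graft_list
    by (intro sum.cong) (auto simp: lin_scale simp del: fvs.scale_scale)
qed


lemma bd_tree_circ:
  fixes dummy :: "'k::field"
  shows "1 \<le> i \<Longrightarrow> i \<le> leaves T \<Longrightarrow>
      lin tree_bd (tree_circ i T S :: tree \<Rightarrow>\<^sub>0 'k)
      = lin (\<lambda>T'. tree_circ i T' S) (tree_bd T)
        + scale (ksign (tdeg T)) (lin (tree_circ i T) (tree_bd S))"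
    and "1 \<le> i \<Longrightarrow> i \<le> leaves_list ts \<Longrightarrow>
      lin list_bd (list_circ i ts S :: tree list \<Rightarrow>\<^sub>0 'k)
      = lin (\<lambda>us. list_circ i us S) (list_bd ts)
        + scale (ksign (tdeg_list ts)) (lin (list_circ i ts) (tree_bd S))"
proof (induction T and ts arbitrary: i and i rule: leaves_leaves_list.induct)
  case 1
  have "tree_circ i Leaf = (vec :: tree \<Rightarrow> tree \<Rightarrow>\<^sub>0 'k)"
    by (rule ext) (simp add: tree_circ_def ksign_def)
  then show ?case by (simp add: ksign_def)
next
  case (2 ts)
  let ?N = "lin (\<lambda>us. vec (Node us)) :: _ \<Rightarrow> tree \<Rightarrow>\<^sub>0 'k"
  have N: "tree_circ i (Node us) U = ?N (list_circ i us U)" for us U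
    by (simp add: tree_circ_def list_circ_def lin_scale)
  have N': "tree_circ i (Node us) = (\<lambda>U. ?N (list_circ i us U))" for us
    by (rule ext) (rule N)
  have i: "1 \<le> i" "i \<le> leaves_list ts" using 2 by auto
  have "lin tree_bd (tree_circ i (Node ts) S :: tree \<Rightarrow>\<^sub>0 'k)
      = lin (\<lambda>T. tree_circ i T S) (node_bd ts)
        + scale (ksign (int (length ts) - 2)) (?N (lin list_bd (list_circ i ts S)))"
    unfolding node_bd_derivation[OF i, symmetric]
    by (simp add: tree_circ_def list_circ_def lin_scale fvs.scale_right_distrib mult.commute)
  also have "\<dots> = lin (\<lambda>T'. tree_circ i T' S) (tree_bd (Node ts))
        + scale (ksign (tdeg (Node ts))) (lin (tree_circ i (Node ts)) (tree_bd S))"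
    by (simp add: 2(1)[OF i] N' lin_add lin_scale fvs.scale_right_distrib lin_lin ksign_mult
        add.assoc)
  finally show ?case .
next
  case (4 t ts)
  show ?case
  proof (cases "i \<le> leaves t")
    case True
    let ?C = "lin (\<lambda>u. vec (u # ts)) :: _ \<Rightarrow> tree list \<Rightarrow>\<^sub>0 'k"
    let ?\<sigma> = "ksign (tdeg S * tdeg_list ts) :: 'k"
    have c1: "list_circ i (u # ts) S = scale ?\<sigma> (?C (tree_circ i u S))"
      if "leaves u = leaves t" for u
      using True that
      by (simp add: tree_circ_def list_circ_def lin_scale ksign_mult del: fvs.scale_cancel_right)
        (rule scale_ksign_cong, simp add: algebra_simps)
    have c2: "list_circ i (t # us) S
        = scale (ksign (tdeg S * (tdeg_list ts - 1))) (lin (\<lambda>u. vec (u # us)) (tree_circ i t S :: tree \<Rightarrow>\<^sub>0 'k))"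
      if "tdeg_list us = tdeg_list ts - 1" for us
      using True that
      by (simp add: tree_circ_def list_circ_def lin_scale ksign_mult del: fvs.scale_cancel_right)
        (rule scale_ksign_cong, simp add: algebra_simps)
    have c3: "list_circ i (t # ts) U
        = scale (ksign ((tdeg S - 1) * tdeg_list ts)) (?C (tree_circ i t U))"
      if "tdeg U = tdeg S - 1" for U
      using True that
      by (simp add: tree_circ_def list_circ_def lin_scale ksign_mult del: fvs.scale_cancel_right)
        (rule scale_ksign_cong, simp add: algebra_simps)
    have "lin list_bd (list_circ i (t # ts) S :: tree list \<Rightarrow>\<^sub>0 'k)
      = scale ?\<sigma> (?C (lin tree_bd (tree_circ i t S)))
        + scale (ksign (tdeg S * (tdeg_list ts - 1) + tdeg t))
            (lin (\<lambda>us. lin (\<lambda>u. vec (u # us)) (tree_circ i t S)) (list_bd ts))"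
      unfolding c1[OF refl]
      using True 4(3) tdeg_graft(1)[of i t S]
      by (simp add: tree_circ_def lin_scale lin_fun_scale fvs.scale_right_distrib ksign_mult
            del: fvs.scale_cancel_right)
        (rule arg_cong2[where f = "(+)"] refl scale_ksign_cong, simp add: algebra_simps)+
    also have "lin (\<lambda>us. lin (\<lambda>u. vec (u # us)) (tree_circ i t S)) (list_bd ts)
      = scale (ksign (tdeg S * (tdeg_list ts - 1))) (lin (\<lambda>us. list_circ i (t # us) S) (list_bd ts :: _ \<Rightarrow>\<^sub>0 'k))"
      unfolding lin_fun_scale[symmetric]
      by (rule lin_cong) (simp add: c2 keys_bd(2) ksign_mult, simp add: ksign_def)
    also have "scale ?\<sigma> (?C (lin tree_bd (tree_circ i t S)))
      = lin (\<lambda>u. list_circ i (u # ts) S) (tree_bd t)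
        + scale (ksign (tdeg_list (t # ts))) (lin (list_circ i (t # ts)) (tree_bd S))"
    proof -
      have "lin (\<lambda>u. list_circ i (u # ts) S) (tree_bd t)
        = lin (\<lambda>u. scale ?\<sigma> (?C (tree_circ i u S))) (tree_bd t)"
        by (rule lin_cong) (simp add: c1 keys_bd(1))
      moreover have "lin (list_circ i (t # ts)) (tree_bd S)
        = lin (\<lambda>U. scale (ksign ((tdeg S - 1) * tdeg_list ts)) (?C (tree_circ i t U))) (tree_bd S)"
        by (rule lin_cong) (simp add: c3 keys_bd(1))
      ultimately show ?thesis
        using 4(1)[OF 4(3) True]
        by (simp add: lin_fun_scale lin_add lin_scale lin_lin fvs.scale_right_distrib ksign_mult
            del: fvs.scale_cancel_right)
          (rule scale_ksign_cong, simp add: algebra_simps)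
    qed
    finally show ?thesis
      by (simp add: lin_add lin_scale lin_lin ksign_mult)
        (simp add: ksign_def add_ac)
  next
    case False
    let ?C = "lin (\<lambda>us. vec (t # us)) :: _ \<Rightarrow> tree list \<Rightarrow>\<^sub>0 'k"
    let ?j = "i - leaves t"
    have j: "1 \<le> ?j" "?j \<le> leaves_list ts" using False 4(3,4) by auto
    have c1: "list_circ i (u # us) U = lin (\<lambda>us. vec (u # us)) (list_circ ?j us U :: _ \<Rightarrow>\<^sub>0 'k)"
      if "leaves u = leaves t" for u us U
      using False that by (simp add: list_circ_def lin_scale)
    have c1': "list_circ i (t # us) = (\<lambda>U. ?C (list_circ ?j us U))" for us
      by (rule ext) (rule c1[OF refl])
    have "lin list_bd (list_circ i (t # ts) S :: tree list \<Rightarrow>\<^sub>0 'k)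
      = lin (\<lambda>u. lin (\<lambda>us. vec (u # us)) (list_circ ?j ts S)) (tree_bd t)
        + scale (ksign (tdeg t)) (?C (lin list_bd (list_circ ?j ts S)))"
      unfolding c1[OF refl]
      by (simp add: list_circ_def lin_scale lin_fun_scale fvs.scale_right_distrib mult.commute)
    also have "lin (\<lambda>u. lin (\<lambda>us. vec (u # us)) (list_circ ?j ts S)) (tree_bd t)
      = lin (\<lambda>u. list_circ i (u # ts) S) (tree_bd t :: _ \<Rightarrow>\<^sub>0 'k)"
      by (rule lin_cong) (simp add: c1 keys_bd(1))
    finally show ?thesis
      using 4(2)[OF j]
      by (simp add: lin_add lin_scale lin_lin c1 c1' fvs.scale_right_distrib ksign_mult add.assoc)
  qed
qed auto


section \<open>\<open>Ainf\<close> is a dg operad\<close>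

lemma bilin_add_left: "bilin f (u + u') v = bilin f u v + bilin f u' v"
  and bilin_scale_left: "bilin f (scale c u) v = scale c (bilin f u v)"
  and bilin_add_right: "bilin f u (v + v') = bilin f u v + bilin f u v'"
  and bilin_scale_right: "bilin f u (scale c v) = scale c (bilin f u v)"
  by (simp_all add: bilin_def lin_add lin_scale lin_fun_add lin_fun_scale)

lemma bilin_zero [simp]: "bilin f 0 v = 0" "bilin f u 0 = 0"
  by (simp_all add: bilin_def)

lemma bilin_sum_left: "bilin f (sum g A) v = (\<Sum>x\<in>A. bilin f (g x) v)"
  and bilin_sum_right: "bilin f u (sum h A) = (\<Sum>x\<in>A. bilin f u (h x))"
proof -
  interpret l: Vector_Spaces.linear scale scale "\<lambda>u. bilin f u v" by (rule linear_bilin_left)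
  interpret r: Vector_Spaces.linear scale scale "bilin f u" by (rule linear_bilin_right)
  show "bilin f (sum g A) v = (\<Sum>x\<in>A. bilin f (g x) v)" by (rule l.sum)
  show "bilin f u (sum h A) = (\<Sum>x\<in>A. bilin f u (h x))" by (rule r.sum)
qed

lemmas bilin_simps = bilin_add_left bilin_scale_left bilin_add_right bilin_scale_right
  lin_add lin_scale fvs.scale_right_distrib

lemma linearI:
  "(\<And>u v. f (u + v) = f u + f v) \<Longrightarrow> (\<And>c v. f (scale c v) = scale c (f v)) \<Longrightarrow>
    Vector_Spaces.linear scale scale (f :: ('a \<Rightarrow>\<^sub>0 'k::field) \<Rightarrow> ('b \<Rightarrow>\<^sub>0 'k))"
  by (simp add: Vector_Spaces.linear_iff fvs.vector_space_axioms)

lemma Ainf_simps [simp]: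
  "basis Ainf = {t. proper t \<and> t \<noteq> Leaf}" "arity Ainf = leaves" "deg Ainf = tdeg"
  "circ Ainf i = bilin (tree_circ i)" "bd Ainf = lin tree_bd"
  by (simp_all add: Ainf_def)

lemma leaves_ge_1: "proper t \<Longrightarrow> 1 \<le> leaves t"
  and leaves_list_ge: "\<forall>t\<in>set ts. proper t \<Longrightarrow> length ts \<le> leaves_list ts"
  by (induction t and ts rule: leaves_leaves_list.induct) auto

lemma leaves_ge_2: "proper t \<Longrightarrow> t \<noteq> Leaf \<Longrightarrow> 2 \<le> leaves t"
  by (cases t) (use leaves_list_ge in fastforce)+

lemma homogD: "a \<in> homog Ainf n d \<Longrightarrow> t \<in> Poly_Mapping.keys a \<Longrightarrow>
    proper t \<and> t \<noteq> Leaf \<and> leaves t = n \<and> tdeg t = d"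
  by (auto simp: homog_def)

lemma homogI: "(\<And>t. t \<in> Poly_Mapping.keys a \<Longrightarrow>
    proper t \<and> t \<noteq> Leaf \<and> leaves t = n \<and> tdeg t = d) \<Longrightarrow> a \<in> homog Ainf n d"
  by (auto simp: homog_def)

lemma vec_homog:
  "proper t \<Longrightarrow> t \<noteq> Leaf \<Longrightarrow> (vec t :: _ \<Rightarrow>\<^sub>0 'k::field) \<in> homog Ainf (leaves t) (tdeg t)"
  by (auto simp: homog_def)

lemma graft_not_Leaf: "T \<noteq> Leaf \<Longrightarrow> graft i S T \<noteq> Leaf"
  by (cases T) auto

lemma Ainf_circ_homog:
  fixes a b :: "tree \<Rightarrow>\<^sub>0 'k::field"
  assumes "a \<in> homog Ainf r d" "b \<in> homog Ainf s e" "1 \<le> i" "i \<le> r"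
  shows "circ Ainf i a b \<in> homog Ainf (r + s - 1) (d + e)"
proof (rule homogI)
  fix u assume "u \<in> Poly_Mapping.keys (circ Ainf i a b)"
  then obtain t t' where t: "t \<in> Poly_Mapping.keys a" "t' \<in> Poly_Mapping.keys b"
    "u \<in> Poly_Mapping.keys (tree_circ i t t' :: tree \<Rightarrow>\<^sub>0 'k)"
    by (auto simp: bilin_def dest!: keys_linD)
  then have u: "u = graft i t' t"
    using keys_scale by (fastforce simp: tree_circ_def)
  show "proper u \<and> u \<noteq> Leaf \<and> leaves u = r + s - 1 \<and> tdeg u = d + e"
    using homogD[OF assms(1) t(1)] homogD[OF assms(2) t(2)] assms(3,4)
      leaves_graft(1)[of i t t'] tdeg_graft(1)[of i t t'] proper_graft(1)[of t' t i]
      graft_not_Leaf[of t i t']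
    by (simp add: u)
qed

lemma Ainf_bd_homog:
  fixes a :: "tree \<Rightarrow>\<^sub>0 'k::field"
  assumes "a \<in> homog Ainf n d"
  shows "bd Ainf a \<in> homog Ainf n (d - 1)"
proof (rule homogI)
  fix u assume "u \<in> Poly_Mapping.keys (bd Ainf a)"
  then obtain t where t: "t \<in> Poly_Mapping.keys a" "u \<in> Poly_Mapping.keys (tree_bd t :: tree \<Rightarrow>\<^sub>0 'k)"
    by (auto dest!: keys_linD)
  then show "proper u \<and> u \<noteq> Leaf \<and> leaves u = n \<and> tdeg u = d - 1"
    using homogD[OF assms t(1)] keys_bd(1)[OF t(2)] by auto
qed

lemma Ainf_circ_nested:
  fixes a b c :: "tree \<Rightarrow>\<^sub>0 'k::field"
  assumes "a \<in> homog Ainf r d" "b \<in> homog Ainf s e" "c \<in> homog Ainf t f"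
    "1 \<le> i" "i \<le> r" "1 \<le> j" "j \<le> s"
  shows "circ Ainf (i + j - 1) (circ Ainf i a b) c = circ Ainf i a (circ Ainf j b c)"
proof (rule linear_eq_on_keys[where v = a])
  fix T assume T: "T \<in> Poly_Mapping.keys a"
  show "circ Ainf (i + j - 1) (circ Ainf i (vec T) b) c = circ Ainf i (vec T) (circ Ainf j b c)"
  proof (rule linear_eq_on_keys[where v = b])
    fix S assume S: "S \<in> Poly_Mapping.keys b"
    show "circ Ainf (i + j - 1) (circ Ainf i (vec T) (vec S)) c
        = circ Ainf i (vec T) (circ Ainf j (vec S) c)"
    proof (rule linear_eq_on_keys[where v = c])
      fix U assume U: "U \<in> Poly_Mapping.keys c"
      have *: "1 \<le> i" "i \<le> leaves T" "1 \<le> j" "j \<le> leaves S"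
        using homogD[OF assms(1) T] homogD[OF assms(2) S] assms by auto
      show "circ Ainf (i + j - 1) (circ Ainf i (vec T) (vec S)) (vec U)
          = circ Ainf i (vec T) (circ Ainf j (vec S) (vec U))"
        by (simp add: tree_circ_def bilin_simps graft_nested(1)[OF *, unfolded One_nat_def]
            after_nested(1)[OF *, unfolded One_nat_def]
            tdeg_graft(1)[OF *(3,4), unfolded One_nat_def] ksign_mult del: fvs.scale_cancel_right)
          (rule scale_ksign_cong, simp add: algebra_simps)
    qed (auto intro!: linearI simp: bilin_simps)
  qed (auto intro!: linearI simp: bilin_simps)
qed (auto intro!: linearI simp: bilin_simps)

lemma Ainf_circ_parallel:
  fixes a b c :: "tree \<Rightarrow>\<^sub>0 'k::field"
  assumes "a \<in> homog Ainf r d" "b \<in> homog Ainf s e" "c \<in> homog Ainf t f"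
    "1 \<le> i" "i < j" "j \<le> r"
  shows "circ Ainf (j + s - 1) (circ Ainf i a b) c
    = scale (ksign (e * f)) (circ Ainf i (circ Ainf j a c) b)"
proof (rule linear_eq_on_keys[where v = a])
  fix T assume T: "T \<in> Poly_Mapping.keys a"
  show "circ Ainf (j + s - 1) (circ Ainf i (vec T) b) c
    = scale (ksign (e * f)) (circ Ainf i (circ Ainf j (vec T) c) b)"
  proof (rule linear_eq_on_keys[where v = b])
    fix S assume S: "S \<in> Poly_Mapping.keys b"
    show "circ Ainf (j + s - 1) (circ Ainf i (vec T) (vec S)) c
      = scale (ksign (e * f)) (circ Ainf i (circ Ainf j (vec T) c) (vec S))"
    proof (rule linear_eq_on_keys[where v = c])
      fix U assume U: "U \<in> Poly_Mapping.keys c"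
      have *: "1 \<le> i" "i < j" "j \<le> leaves T" "s = leaves S" "e = tdeg S" "f = tdeg U"
        using homogD[OF assms(1) T] homogD[OF assms(2) S] homogD[OF assms(3) U] assms by auto
      show "circ Ainf (j + s - 1) (circ Ainf i (vec T) (vec S)) (vec U)
        = scale (ksign (e * f)) (circ Ainf i (circ Ainf j (vec T) (vec U)) (vec S))"
        using graft_parallel(1)[OF *(1-3), of S U]
        by (simp add: * tree_circ_def bilin_simps ksign_mult del: fvs.scale_cancel_right)
          (rule scale_ksign_cong, simp add: algebra_simps)
    qed (auto intro!: linearI simp: bilin_simps mult.commute)
  qed (auto intro!: linearI simp: bilin_simps mult.commute)
qed (auto intro!: linearI simp: bilin_simps mult.commute)

lemma Ainf_bd_circ:
  fixes a b :: "tree \<Rightarrow>\<^sub>0 'k::field"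
  assumes "a \<in> homog Ainf r d" "1 \<le> i" "i \<le> r"
  shows "bd Ainf (circ Ainf i a b)
    = circ Ainf i (bd Ainf a) b + scale (ksign d) (circ Ainf i a (bd Ainf b))"
proof (rule linear_eq_on_keys[where v = a])
  fix T assume T: "T \<in> Poly_Mapping.keys a"
  show "bd Ainf (circ Ainf i (vec T) b)
    = circ Ainf i (bd Ainf (vec T)) b + scale (ksign d) (circ Ainf i (vec T) (bd Ainf b))"
  proof (rule linear_eq_on_keys[where v = b])
    fix S assume S: "S \<in> Poly_Mapping.keys b"
    show "bd Ainf (circ Ainf i (vec T) (vec S :: _ \<Rightarrow>\<^sub>0 'k))
      = circ Ainf i (bd Ainf (vec T)) (vec S) + scale (ksign d) (circ Ainf i (vec T) (bd Ainf (vec S)))"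
      using bd_tree_circ(1)[of i T S, where 'k = 'k] homogD[OF assms(1) T] assms(2,3)
      by (simp add: bilin_def)
  qed (auto intro!: linearI simp: bilin_simps mult.commute)
qed (auto intro!: linearI simp: bilin_simps mult.commute)


lemma leaves_list_replicate [simp]: "leaves_list (replicate n Leaf) = n"
  by (induction n) auto

lemma tdeg_list_replicate [simp]: "tdeg_list (replicate n Leaf) = 0"
  by (induction n) auto

lemma list_bd_replicate [simp]: "list_bd (replicate n Leaf) = 0"
  by (induction n) auto

lemma cgen_homog:
  "2 \<le> n \<Longrightarrow> (cgen n :: _ \<Rightarrow>\<^sub>0 'k::field) \<in> homog Ainf n (int n - 2)"
  using vec_homog[of "Node (replicate n Leaf)"] by (simp add: cgen_def)

lemma graft_list_replicate:
  "1 \<le> i \<Longrightarrow> i \<le> r \<Longrightarrow>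
   graft_list i S (replicate r Leaf) = replicate (i - 1) Leaf @ S # replicate (r - i) Leaf \<and>
   after_list i (replicate r Leaf) = 0"
proof (induction r arbitrary: i)
  case (Suc r)
  show ?case
  proof (cases "i = 1")
    case False
    then obtain k where "i = Suc (Suc k)" using Suc.prems by (metis One_nat_def not0_implies_Suc not_less_eq_eq le_zero_eq)
    then show ?thesis using Suc.IH[of "Suc k"] Suc.prems by simp
  qed (use Suc in auto)
qed auto

theorem Ainf_bd_cgen:
  "bd Ainf (cgen n :: _ \<Rightarrow>\<^sub>0 'k::field)
    = (\<Sum>(r, s, i)\<in>cindices n. scale (ksign (int ((r + i) * s + i))) (circ Ainf i (cgen r) (cgen s)))"
proof -
  have "vec (face s i (replicate n Leaf)) = (circ Ainf i (cgen r) (cgen s) :: _ \<Rightarrow>\<^sub>0 'k)"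
    if "(r, s, i) \<in> cindices n" for r s i
  proof -
    have c: "r + s = n + 1" "2 \<le> r" "2 \<le> s" "1 \<le> i" "i \<le> r"
      using that by (auto simp: cindices_def)
    then have e: "replicate n Leaf
        = replicate (i - 1) Leaf @ replicate s Leaf @ replicate (r - i) Leaf"
      by (simp flip: replicate_add)
    have "face s i (replicate n Leaf)
        = Node (replicate (i - 1) Leaf @ Node (replicate s Leaf) # replicate (r - i) Leaf)"
      unfolding e by (rule face_eq) auto
    then show ?thesis
      using graft_list_replicate[OF c(4,5)] by (simp add: cgen_def tree_circ_def ksign_def)
  qed
  moreover have "tdeg_list (take m (replicate n Leaf)) = 0" for m
    by (simp add: take_replicate)
  ultimately have "node_bd (replicate n Leaf)
    = (\<Sum>(r, s, i)\<in>cindices n.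
        scale (ksign (int ((r + i) * s + i))) (circ Ainf i (cgen r) (cgen s) :: _ \<Rightarrow>\<^sub>0 'k))"
    unfolding node_bd_def by (intro sum.cong) (auto simp: ksign_def)
  then show ?thesis by (simp add: cgen_def)
qed

lemma tree_decompose:
  assumes "proper T" "T \<noteq> Leaf"
  obtains (corolla) n where "2 \<le> n" "T = Node (replicate n Leaf)"
    | (graft) T' S i where "proper T'" "T' \<noteq> Leaf" "proper S" "S \<noteq> Leaf"
        "1 \<le> i" "i \<le> leaves T'" "T = graft i S T'" "size T' < size T" "size S < size T"
proof -
  obtain ts where T: "T = Node ts" using assms(2) by (cases T) auto
  show thesis
  proof (cases "\<forall>t\<in>set ts. t = Leaf")
    case True
    then have "ts = replicate (length ts) Leaf" by (simp add: replicate_length_same)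
    then show thesis using corolla[of "length ts"] assms T by auto
  next
    case False
    then obtain t where "t \<in> set ts" "t \<noteq> Leaf" by blast
    then obtain p z where ts: "ts = p @ t # z" by (meson split_list)
    let ?T' = "Node (p @ Leaf # z)" and ?i = "leaves_list p + 1"
    have eq: "graft ?i t ?T' = T" by (simp add: T ts graft_list_append)
    have "0 < size t" using \<open>t \<noteq> Leaf\<close> by (cases t) auto
    show thesis
    proof (rule graft[of ?T' t ?i])
      show "T = graft ?i t ?T'" by (simp only: eq)
    qed (use assms \<open>t \<noteq> Leaf\<close> \<open>0 < size t\<close> in \<open>auto simp: T ts\<close>)
  qed
qed

lemma Ainf_vec_graft:
  "(vec (graft i S T) :: tree \<Rightarrow>\<^sub>0 'k::field)
    = scale (ksign (tdeg S * after i T)) (circ Ainf i (vec T) (vec S))"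
proof -
  have "ksign n * ksign n = (1 :: 'k)" for n by (simp add: ksign_def)
  then show ?thesis by (simp add: tree_circ_def)
qed


definition triples :: "nat \<Rightarrow> (nat \<times> nat \<times> nat \<times> nat \<times> nat) set" where
  "triples n = {(m, s, i, t, j). 2 \<le> m \<and> 2 \<le> s \<and> 2 \<le> t \<and> m + s + t = n + 2 \<and>
     1 \<le> i \<and> i \<le> m \<and> 1 \<le> j \<and> j \<le> m + s - 1}"

lemma finite_triples: "finite (triples n)"
  by (rule finite_subset[of _ "{..n+2} \<times> {..n+2} \<times> {..n+2} \<times> {..n+2} \<times> {..n+2}"])
     (auto simp: triples_def)

lemma Ainf_bd_bd_cgen: "bd Ainf (bd Ainf (cgen n)) = (0 :: tree \<Rightarrow>\<^sub>0 'k::field)"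
proof -
  let ?c = "cgen :: nat \<Rightarrow> tree \<Rightarrow>\<^sub>0 'k"
  define e :: "nat \<times> nat \<times> nat \<Rightarrow> int" where "e = (\<lambda>(r, s, i). int ((r + i) * s + i))"
  define X where "X = (\<lambda>(m, s, i, t, j).
    scale (ksign (e (m + s - 1, t, j) + e (m, s, i)) :: 'k) (circ Ainf j (circ Ainf i (?c m) (?c s)) (?c t)))"
  define Y where "Y = (\<lambda>(m, s, i, t, j).
    scale (ksign (e (m, s + t - 1, i) + int m + e (s, t, j)) :: 'k) (circ Ainf i (?c m) (circ Ainf j (?c s) (?c t))))"
  define A where "A = {(m, s, i, t, j) \<in> triples n. j < i}"
  define B where "B = {(m, s, i, t, j) \<in> triples n. i \<le> j \<and> j < i + s}"
  define C where "C = {(m, s, i, t, j) \<in> triples n. i + s \<le> j}"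
  define D where "D = {(m, s, i, t, j). 2 \<le> m \<and> 2 \<le> s \<and> 2 \<le> t \<and> m + s + t = n + 2 \<and>
     1 \<le> i \<and> i \<le> m \<and> 1 \<le> j \<and> j \<le> s}"
  have b: "bd Ainf (?c m) = (\<Sum>x\<in>cindices m.
      scale (ksign (e x)) (case x of (r, s, i) \<Rightarrow> circ Ainf i (?c r) (?c s)))" for m
    unfolding Ainf_bd_cgen e_def by (rule sum.cong) auto
  have d: "bd Ainf (circ Ainf i (?c r) (?c s))
      = circ Ainf i (bd Ainf (?c r)) (?c s) + scale (ksign (int r)) (circ Ainf i (?c r) (bd Ainf (?c s)))"
    if "(r, s, i) \<in> cindices n" for r s i
  proof -
    have "scale (ksign (int r - 2)) v = scale (ksign (int r)) (v :: tree \<Rightarrow>\<^sub>0 'k)" for v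
      by (rule scale_ksign_cong) simp
    then show ?thesis
      using that Ainf_bd_circ[OF cgen_homog[of r], of i "?c s"] by (auto simp: cindices_def)
  qed
  have "bd Ainf (bd Ainf (?c n))
     = (\<Sum>x\<in>cindices n. scale (ksign (e x))
         (bd Ainf (case x of (r, s, i) \<Rightarrow> circ Ainf i (?c r) (?c s))))"
    unfolding b[of n] by (simp add: lin_sum lin_scale del: Ainf_simps(4))
  also have "\<dots> = (\<Sum>x\<in>cindices n. scale (ksign (e x))
         (case x of (r, s, i) \<Rightarrow> circ Ainf i (bd Ainf (?c r)) (?c s)
           + scale (ksign (int r)) (circ Ainf i (?c r) (bd Ainf (?c s)))))"
    by (rule sum.cong[OF refl]) (clarsimp simp only: prod.case d split: prod.split)
  also have "\<dots> = (\<Sum>x\<in>cindices n. \<Sum>y\<in>cindices (fst x).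
         case (x, y) of ((r, t, j), (m, s, i)) \<Rightarrow> X (m, s, i, t, j))
      + (\<Sum>x\<in>cindices n. \<Sum>y\<in>cindices (fst (snd x)).
         case (x, y) of ((m, r, i), (s, t, j)) \<Rightarrow> Y (m, s, i, t, j))"
    unfolding sum.distrib[symmetric]
  proof (rule sum.cong[OF refl])
    fix x assume "x \<in> cindices n"
    obtain r t j where x: "x = (r, t, j)" by (cases x)
    have "scale (ksign (e (r, t, j))) (circ Ainf j (bd Ainf (?c r)) (?c t))
      = (\<Sum>y\<in>cindices r. case y of (m, s, i) \<Rightarrow> X (m, s, i, t, j))"
      unfolding b bilin_sum_left fvs.scale_sum_right Ainf_simps(4)
    proof (rule sum.cong[OF refl], clarify)
      fix m s i assume "(m, s, i) \<in> cindices r"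
      then have "r = m + s - 1" by (auto simp: cindices_def)
      then show "scale (ksign (e (r, t, j))) (bilin (tree_circ j)
          (scale (ksign (e (m, s, i))) (bilin (tree_circ i) (?c m) (?c s))) (?c t)) = X (m, s, i, t, j)"
        by (simp add: X_def bilin_scale_left ksign_mult)
    qed
    moreover have "scale (ksign (e (r, t, j))) (scale (ksign (int r)) (circ Ainf j (?c r) (bd Ainf (?c t))))
      = (\<Sum>y\<in>cindices t. case y of (s, t, k) \<Rightarrow> Y (r, s, j, t, k))"
      unfolding b bilin_sum_right fvs.scale_sum_right Ainf_simps(4)
    proof (rule sum.cong[OF refl], clarify)
      fix s u k assume "(s, u, k) \<in> cindices t"
      then have "t = s + u - 1" by (auto simp: cindices_def)
      then show "scale (ksign (e (r, t, j))) (scale (ksign (int r)) (bilin (tree_circ j) (?c r)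
          (scale (ksign (e (s, u, k))) (bilin (tree_circ k) (?c s) (?c u))))) = Y (r, s, j, u, k)"
        by (simp add: Y_def bilin_scale_right ksign_mult add.assoc)
    qed
    ultimately show "scale (ksign (e x))
         (case x of (r, s, i) \<Rightarrow> circ Ainf i (bd Ainf (?c r)) (?c s)
           + scale (ksign (int r)) (circ Ainf i (?c r) (bd Ainf (?c s))))
      = (\<Sum>y\<in>cindices (fst x). case (x, y) of ((r, t, j), (m, s, i)) \<Rightarrow> X (m, s, i, t, j))
        + (\<Sum>y\<in>cindices (fst (snd x)). case (x, y) of ((m, r, i), (s, t, j)) \<Rightarrow> Y (m, s, i, t, j))"
      by (simp add: x fvs.scale_right_distrib del: Ainf_simps fvs.scale_scale)
  qed
  also have "(\<Sum>x\<in>cindices n. \<Sum>y\<in>cindices (fst x).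
         case (x, y) of ((r, t, j), (m, s, i)) \<Rightarrow> X (m, s, i, t, j)) = sum X (triples n)"
    unfolding sum.Sigma[OF finite_cindices ballI[OF finite_cindices]]
    by (rule sum.reindex_bij_witness[of _
          "\<lambda>(m, s, i, t, j). ((m + s - 1, t, j), (m, s, i))"
          "\<lambda>((r, t, j), (m, s, i)). (m, s, i, t, j)"])
       (auto simp: cindices_def triples_def)
  also have "sum X (triples n) = sum X A + sum X B + sum X C"
  proof -
    have fin: "finite A" "finite B" "finite C"
      unfolding A_def B_def C_def by (auto intro: finite_subset[OF _ finite_triples])
    have "triples n = (A \<union> B) \<union> C" "A \<inter> B = {}" "(A \<union> B) \<inter> C = {}"
      by (auto simp: A_def B_def C_def)
    then show ?thesis using fin by (simp add: sum.union_disjoint)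
  qed
  also have "(\<Sum>x\<in>cindices n. \<Sum>y\<in>cindices (fst (snd x)).
         case (x, y) of ((m, r, i), (s, t, j)) \<Rightarrow> Y (m, s, i, t, j)) = sum Y D"
    unfolding sum.Sigma[OF finite_cindices ballI[OF finite_cindices]]
    by (rule sum.reindex_bij_witness[of _
          "\<lambda>(m, s, i, t, j). ((m, s + t - 1, i), (s, t, j))"
          "\<lambda>((m, r, i), (s, t, j)). (m, s, i, t, j)"])
       (auto simp: cindices_def D_def)
  also have "sum X C = - sum X A"
    unfolding sum_negf[symmetric]
  proof (rule sum.reindex_bij_witness[of _
        "\<lambda>(m, t, k, s, i). (m, s, i, t, k + s - 1)" "\<lambda>(m, s, i, t, j). (m, t, j + 1 - s, s, i)"])
    fix x assume "x \<in> C"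
    then obtain m s i t j where x: "x = (m, s, i, t, j)" and c: "2 \<le> m" "2 \<le> s" "2 \<le> t"
      "m + s + t = n + 2" "1 \<le> i" "i \<le> m" "i + s \<le> j" "j \<le> m + s - 1"
      by (auto simp: C_def triples_def)
    define k where "k = j + 1 - s"
    obtain s' where s': "s = Suc s'" using c by (cases s) auto
    obtain t' where t': "t = Suc t'" using c by (cases t) auto
    have k: "j = k + s'" "i < k" "k \<le> m" using c by (auto simp: k_def s')
    have "circ Ainf (k + s - 1) (circ Ainf i (?c m) (?c s)) (?c t)
        = scale (ksign ((int s - 2) * (int t - 2))) (circ Ainf i (circ Ainf k (?c m) (?c t)) (?c s))"
      by (rule Ainf_circ_parallel[OF cgen_homog cgen_homog cgen_homog]) (use c k in auto)
    then have "X (m, s, i, t, j) = scale (ksign (e (m + s - 1, t, j) + e (m, s, i)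
        + (int s - 2) * (int t - 2))) (circ Ainf i (circ Ainf k (?c m) (?c t)) (?c s))"
      by (simp add: X_def k(1) s' ksign_mult)
    also have "\<dots> = scale (ksign (1 + (e (m + t - 1, s, i) + e (m, t, k))))
        (circ Ainf i (circ Ainf k (?c m) (?c t)) (?c s))"
      by (rule scale_ksign_cong) (simp add: e_def k(1) s' t'; blast)
    also have "\<dots> = - X (m, t, k, s, i)"
      by (simp add: X_def ksign_mult[symmetric] flip: fvs.scale_scale) (simp add: ksign_def)
    finally show "- X (case x of (m, s, i, t, j) \<Rightarrow> (m, t, j + 1 - s, s, i)) = X x"
      by (simp add: x k_def)
  qed (auto simp: A_def C_def triples_def)
  also have "sum X B = - sum Y D"
    unfolding sum_negf[symmetric]
  proof (rule sum.reindex_bij_witness[of _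
        "\<lambda>(m, s, i, t, k). (m, s, i, t, i + k - 1)" "\<lambda>(m, s, i, t, j). (m, s, i, t, j + 1 - i)"])
    fix x assume "x \<in> B"
    then obtain m s i t j where x: "x = (m, s, i, t, j)" and c: "2 \<le> m" "2 \<le> s" "2 \<le> t"
      "m + s + t = n + 2" "1 \<le> i" "i \<le> m" "i \<le> j" "j < i + s"
      by (auto simp: B_def triples_def)
    define k where "k = j + 1 - i"
    obtain i' where i': "i = Suc i'" using c by (cases i) auto
    obtain s' where s': "s = Suc s'" using c by (cases s) auto
    have k: "j = k + i'" "1 \<le> k" "k \<le> s" using c by (auto simp: k_def i')
    have "circ Ainf (i + k - 1) (circ Ainf i (?c m) (?c s)) (?c t)
        = circ Ainf i (?c m) (circ Ainf k (?c s) (?c t))"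
      by (rule Ainf_circ_nested[OF cgen_homog cgen_homog cgen_homog]) (use c k in auto)
    then have "X (m, s, i, t, j) = scale (ksign (e (m + s - 1, t, j) + e (m, s, i)))
        (circ Ainf i (?c m) (circ Ainf k (?c s) (?c t)))"
      by (simp add: X_def k(1) i' add.commute)
    also have "\<dots> = scale (ksign (1 + (e (m, s + t - 1, i) + int m + e (s, t, k))))
        (circ Ainf i (?c m) (circ Ainf k (?c s) (?c t)))"
      by (rule scale_ksign_cong) (simp add: e_def k(1) s' i'; blast)
    also have "\<dots> = - Y (m, s, i, t, k)"
      by (simp add: Y_def ksign_mult[symmetric] flip: fvs.scale_scale) (simp add: ksign_def)
    finally show "- Y (case x of (m, s, i, t, j) \<Rightarrow> (m, s, i, t, j + 1 - i)) = X x"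
      by (simp add: x k_def)
  qed (auto simp: B_def D_def triples_def)
  finally show ?thesis by simp
qed

lemma Ainf_bd_bd_vec: "proper T \<Longrightarrow> T \<noteq> Leaf \<Longrightarrow> bd Ainf (bd Ainf (vec T)) = (0 :: tree \<Rightarrow>\<^sub>0 'k::field)"
proof (induction "size T" arbitrary: T rule: less_induct)
  case less
  from less.prems show ?case
  proof (cases rule: tree_decompose)
    case (corolla n)
    then show ?thesis using Ainf_bd_bd_cgen[of n] by (simp add: cgen_def)
  next
    case (graft T' S i)
    let ?T = "vec T' :: tree \<Rightarrow>\<^sub>0 'k" and ?S = "vec S :: tree \<Rightarrow>\<^sub>0 'k"
    let ?d = "tdeg T'"
    have T': "?T \<in> homog Ainf (leaves T') ?d" using graft by (intro vec_homog)
    have i: "1 \<le> i" "i \<le> leaves T'" using graft by auto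
    note T'2 = Ainf_bd_homog[OF T']
    have IH: "bd Ainf (bd Ainf ?T) = 0" "bd Ainf (bd Ainf ?S) = 0"
      using less.hyps graft by auto
    have "bd Ainf (bd Ainf (circ Ainf i ?T ?S))
      = scale (ksign (?d - 1)) (circ Ainf i (bd Ainf ?T) (bd Ainf ?S))
        + scale (ksign ?d) (circ Ainf i (bd Ainf ?T) (bd Ainf ?S))"
      unfolding Ainf_bd_circ[OF T' i]
      using Ainf_bd_circ[OF T'2 i, of ?S] Ainf_bd_circ[OF T' i, of "bd Ainf ?S"] IH
      by (simp add: lin_add lin_scale del: lin_vec)
    also have "\<dots> = 0" by (simp add: ksign_def)
    finally have "bd Ainf (bd Ainf (circ Ainf i ?T ?S)) = 0" .
    then show ?thesis
      by (simp only: graft(7) Ainf_vec_graft Ainf_simps lin_scale fvs.scale_zero_right)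
  qed
qed

lemma Ainf_bd_bd:
  fixes a :: "tree \<Rightarrow>\<^sub>0 'k::field"
  assumes "a \<in> homog Ainf n d"
  shows "bd Ainf (bd Ainf a) = 0"
proof (rule linear_eq_on_keys[where v = a and g = "\<lambda>_. 0"])
  fix T assume T: "T \<in> Poly_Mapping.keys a"
  show "bd Ainf (bd Ainf (vec T :: tree \<Rightarrow>\<^sub>0 'k)) = 0"
    using homogD[OF assms T] by (intro Ainf_bd_bd_vec) auto
qed (auto intro!: linearI simp: bilin_simps)

theorem dg_operad_Ainf: "dg_operad (Ainf :: (tree, 'k::field) dg_data)"
proof (rule dg_operad.intro)
  show "2 \<le> arity Ainf x" if "x \<in> basis (Ainf :: (tree, 'k) dg_data)" for x
    using that leaves_ge_2 by simp
  show "Vector_Spaces.linear scale scale (\<lambda>a. circ Ainf i a (b :: tree \<Rightarrow>\<^sub>0 'k))" for i b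
    unfolding Ainf_simps by (rule linear_bilin_left)
  show "Vector_Spaces.linear scale scale (\<lambda>b. circ Ainf i a (b :: tree \<Rightarrow>\<^sub>0 'k))" for i a
    unfolding Ainf_simps by (rule linear_bilin_right)
  show "Vector_Spaces.linear scale scale (bd (Ainf :: (tree, 'k) dg_data))"
    unfolding Ainf_simps by (rule linear_lin)
qed (fact Ainf_circ_homog Ainf_circ_nested Ainf_circ_parallel Ainf_bd_homog Ainf_bd_bd
    | rule Ainf_bd_circ; assumption)+


section \<open>Freeness\<close>

fun free_ev :: "('c, 'k::field) dg_data \<Rightarrow> (nat \<Rightarrow> ('c \<Rightarrow>\<^sub>0 'k)) \<Rightarrow> tree \<Rightarrow> ('c \<Rightarrow>\<^sub>0 'k)"
  and free_ev_list :: "('c, 'k::field) dg_data \<Rightarrow> (nat \<Rightarrow> ('c \<Rightarrow>\<^sub>0 'k)) \<Rightarrow>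
    ('c \<Rightarrow>\<^sub>0 'k) \<Rightarrow> nat \<Rightarrow> tree list \<Rightarrow> ('c \<Rightarrow>\<^sub>0 'k)" where
  "free_ev Q q Leaf = 0"
| "free_ev Q q (Node ts) = free_ev_list Q q (q (length ts)) 1 ts"
| "free_ev_list Q q x k [] = x"
| "free_ev_list Q q x k (t # ts) =
     (if t = Leaf then free_ev_list Q q x (k + 1) ts
      else free_ev_list Q q (circ Q k x (free_ev Q q t)) (k + leaves t) ts)"

lemma homog_scale: "x \<in> homog P n d \<Longrightarrow> scale c x \<in> homog P n d"
  by (auto simp: homog_def dest!: keys_scaleD)

lemma homog_add: "x \<in> homog P n d \<Longrightarrow> y \<in> homog P n d \<Longrightarrow> x + y \<in> homog P n d"
  by (auto simp: homog_def dest!: keys_addD)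

lemma homog_sum: "(\<And>i. i \<in> I \<Longrightarrow> f i \<in> homog P n d) \<Longrightarrow> sum f I \<in> homog P n d"
  by (auto simp: homog_def dest!: keys_sumD)

lemma homog_lin:
  "(\<And>b. b \<in> Poly_Mapping.keys v \<Longrightarrow> f b \<in> homog P n d) \<Longrightarrow> lin f v \<in> homog P n d"
  unfolding lin_def by (intro homog_sum homog_scale)

locale free_target = dg_operad Q for Q :: "('c, 'k::field) dg_data" +
  fixes q :: "nat \<Rightarrow> ('c \<Rightarrow>\<^sub>0 'k)"
  assumes q_homog: "2 \<le> n \<Longrightarrow> q n \<in> homog Q n (int n - 2)"
begin

abbreviation "ev \<equiv> free_ev Q q"
abbreviation "evl \<equiv> free_ev_list Q q"

lemma circ_scale_left: "circ Q i (scale c x) y = scale c (circ Q i x y)"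
  using circ_linear_left[of i y] by (simp add: Vector_Spaces.linear_iff)

lemma circ_scale_right: "circ Q i x (scale c y) = scale c (circ Q i x y)"
  using circ_linear_right[of i x] by (simp add: Vector_Spaces.linear_iff)

lemma ev_homog:
  "proper t \<Longrightarrow> t \<noteq> Leaf \<Longrightarrow> ev t \<in> homog Q (leaves t) (tdeg t)"
  "\<forall>t\<in>set ts. proper t \<Longrightarrow> x \<in> homog Q r d \<Longrightarrow> 1 \<le> k \<Longrightarrow> k + length ts = r + 1 \<Longrightarrow>
     evl x k ts \<in> homog Q (k - 1 + leaves_list ts) (d + tdeg_list ts)"
proof (induction t and ts arbitrary: and x r d k rule: leaves_leaves_list.induct)
  case (2 ts)
  have "evl (q (length ts)) 1 ts \<in> homog Q (1 - 1 + leaves_list ts) (int (length ts) - 2 + tdeg_list ts)"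
    by (rule 2(1)[OF _ q_homog]) (use 2(2) in auto)
  then show ?case by simp
next
  case (4 t ts)
  show ?case
  proof (cases "t = Leaf")
    case True
    have "evl x (k + 1) ts \<in> homog Q (k + 1 - 1 + leaves_list ts) (d + tdeg_list ts)"
      by (rule 4(2)[where r = r]) (use 4(3-) in auto)
    then show ?thesis using True 4(5) by simp
  next
    case False
    have "circ Q k x (ev t) \<in> homog Q (r + leaves t - 1) (d + tdeg t)"
      by (rule circ_homog) (use 4 False in auto)
    moreover have "1 \<le> leaves t" using 4(3) leaves_ge_1 by simp
    ultimately have "evl (circ Q k x (ev t)) (k + leaves t) ts
        \<in> homog Q (k + leaves t - 1 + leaves_list ts) (d + tdeg t + tdeg_list ts)"
      by (intro 4(2)) (use 4(3-) in auto)
    then show ?thesis using False 4(5) by (simp add: add.assoc)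
  qed
qed auto

lemma evl_scale: "evl (scale c x) k ts = scale c (evl x k ts)"
  by (induction ts arbitrary: x k) (auto simp: circ_scale_left simp del: fvs.scale_scale)

lemma evl_circ:
  "\<forall>t\<in>set ts. proper t \<Longrightarrow> x \<in> homog Q r d \<Longrightarrow> y \<in> homog Q s e \<Longrightarrow> 1 \<le> i \<Longrightarrow> i < k \<Longrightarrow>
     k + length ts = r + 1 \<Longrightarrow>
     evl (circ Q i x y) (k + s - 1) ts = scale (ksign (e * tdeg_list ts)) (circ Q i (evl x k ts) y)"
proof (induction ts arbitrary: x r d k)
  case Nil
  then show ?case by (simp add: ksign_def)
next
  case (Cons t ts)
  have k: "k + s - 1 + m = k + m + s - 1" for m using Cons.prems by simp
  show ?case
  proof (cases "t = Leaf")
    case True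
    have "evl (circ Q i x y) (k + 1 + s - 1) ts
        = scale (ksign (e * tdeg_list ts)) (circ Q i (evl x (k + 1) ts) y)"
      by (rule Cons.IH[where r = r and d = d]) (use Cons.prems in auto)
    then show ?thesis using True by (simp only: free_ev_list.simps if_True k) simp
  next
    case False
    have t: "ev t \<in> homog Q (leaves t) (tdeg t)" "1 \<le> leaves t"
      using ev_homog(1)[of t] leaves_ge_1[of t] False Cons.prems by auto
    have "circ Q k x (ev t) \<in> homog Q (r + leaves t - 1) (d + tdeg t)"
      by (rule circ_homog) (use Cons.prems t in auto)
    then have "evl (circ Q i (circ Q k x (ev t)) y) (k + leaves t + s - 1) ts
        = scale (ksign (e * tdeg_list ts)) (circ Q i (evl (circ Q k x (ev t)) (k + leaves t) ts) y)"
      by (rule Cons.IH[rotated 1]) (use Cons.prems t in auto)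
    moreover have "circ Q (k + s - 1) (circ Q i x y) (ev t)
        = scale (ksign (e * tdeg t)) (circ Q i (circ Q k x (ev t)) y)"
      by (rule circ_parallel) (use Cons.prems t in auto)
    ultimately show ?thesis
      using False by (simp only: free_ev_list.simps if_False k evl_scale) (simp add: ksign_mult distrib_left)
  qed
qed

lemma ev_graft:
  assumes S: "proper S" "S \<noteq> Leaf"
  shows "proper T \<Longrightarrow> T \<noteq> Leaf \<Longrightarrow> 1 \<le> i \<Longrightarrow> i \<le> leaves T \<Longrightarrow>
      circ Q i (ev T) (ev S) = scale (ksign (tdeg S * after i T)) (ev (graft i S T))"
    and "\<forall>t\<in>set ts. proper t \<Longrightarrow> x \<in> homog Q r d \<Longrightarrow> 1 \<le> k \<Longrightarrow> k + length ts = r + 1 \<Longrightarrow>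
      1 \<le> i \<Longrightarrow> i \<le> leaves_list ts \<Longrightarrow>
      circ Q (k + i - 1) (evl x k ts) (ev S)
        = scale (ksign (tdeg S * after_list i ts)) (evl x k (graft_list i S ts))"
proof (induction T and ts arbitrary: i and x r d k i rule: leaves_leaves_list.induct)
  case (2 ts)
  have "circ Q (1 + i - 1) (evl (q (length ts)) 1 ts) (ev S)
      = scale (ksign (tdeg S * after_list i ts)) (evl (q (length ts)) 1 (graft_list i S ts))"
    by (rule 2(1)[OF _ q_homog]) (use 2(2-) in auto)
  then show ?case by simp
next
  case (4 t ts)
  have S': "ev S \<in> homog Q (leaves S) (tdeg S)" using ev_homog(1) S by blast
  have sq: "scale (ksign a) (scale (ksign a) v) = (v :: 'c \<Rightarrow>\<^sub>0 'k)" for a v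
    by (simp add: ksign_def)
  show ?case
  proof (cases "i \<le> leaves t")
    case True
    show ?thesis
    proof (cases "t = Leaf")
      case l: True
      then have i: "i = 1" using True 4(7) by simp
      have "evl (circ Q k x (ev S)) (k + 1 + leaves S - 1) ts
          = scale (ksign (tdeg S * tdeg_list ts)) (circ Q k (evl x (k + 1) ts) (ev S))"
        by (rule evl_circ[where r = r and d = d]) (use 4(3-) S' in auto)
      then show ?thesis using l i S by (simp add: sq del: fvs.scale_scale)
    next
      case l: False
      have t: "ev t \<in> homog Q (leaves t) (tdeg t)" "1 \<le> leaves t"
        using ev_homog(1)[of t] leaves_ge_1[of t] l 4(3) by auto
      have lg: "leaves (graft i S t) = leaves t + leaves S - 1"
        using leaves_graft(1)[of i t S] True 4(7) by simp
      have c: "circ Q k x (ev t) \<in> homog Q (r + leaves t - 1) (d + tdeg t)"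
        by (rule circ_homog) (use 4(3-) t in auto)
      have "circ Q i (ev t) (ev S) = scale (ksign (tdeg S * after i t)) (ev (graft i S t))"
        using 4(1) 4(3,7) l True by simp
      then have "ev (graft i S t) = scale (ksign (tdeg S * after i t)) (circ Q i (ev t) (ev S))"
        by (simp add: sq del: fvs.scale_scale)
      then have "circ Q k x (ev (graft i S t))
          = scale (ksign (tdeg S * after i t)) (circ Q (k + i - 1) (circ Q k x (ev t)) (ev S))"
        using circ_nested[OF 4(4) t(1) S', of k i] 4(3-) True by (simp add: circ_scale_right)
      moreover have "evl (circ Q (k + i - 1) (circ Q k x (ev t)) (ev S)) (k + leaves t + leaves S - 1) ts
        = scale (ksign (tdeg S * tdeg_list ts))
            (circ Q (k + i - 1) (evl (circ Q k x (ev t)) (k + leaves t) ts) (ev S))"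
        by (rule evl_circ[OF _ c S']) (use 4(3-) True t in auto)
      moreover have "k + leaves (graft i S t) = k + leaves t + leaves S - 1"
        unfolding lg using t by simp
      ultimately have "evl x k (graft_list i S (t # ts))
        = scale (ksign (tdeg S * after_list i (t # ts)))
            (circ Q (k + i - 1) (evl (circ Q k x (ev t)) (k + leaves t) ts) (ev S))"
        using l True graft_not_Leaf[OF l, of i S]
        by (simp add: evl_scale ksign_mult distrib_left)
      then show ?thesis using l by (simp add: sq del: fvs.scale_scale)
    qed
  next
    case False
    have i: "k + leaves t + (i - leaves t) - 1 = k + i - 1" using False by simp
    show ?thesis
    proof (cases "t = Leaf")
      case l: True
      have "circ Q (k + 1 + (i - 1) - 1) (evl x (k + 1) ts) (ev S)
        = scale (ksign (tdeg S * after_list (i - 1) ts)) (evl x (k + 1) (graft_list (i - 1) S ts))"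
        by (rule 4(2)[where r = r and d = d]) (use 4(3-) False l in auto)
      then show ?thesis using l False i by simp
    next
      case l: False
      have t: "ev t \<in> homog Q (leaves t) (tdeg t)" "1 \<le> leaves t"
        using ev_homog(1)[of t] leaves_ge_1[of t] l 4(3) by auto
      have c: "circ Q k x (ev t) \<in> homog Q (r + leaves t - 1) (d + tdeg t)"
        by (rule circ_homog) (use 4(3-) t in auto)
      have "circ Q (k + leaves t + (i - leaves t) - 1) (evl (circ Q k x (ev t)) (k + leaves t) ts) (ev S)
        = scale (ksign (tdeg S * after_list (i - leaves t) ts))
            (evl (circ Q k x (ev t)) (k + leaves t) (graft_list (i - leaves t) S ts))"
        by (rule 4(2)[OF _ c]) (use 4(3-) False l t in auto)
      then show ?thesis using l False i by simp
    qed
  qed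
qed auto

end

text \<open>
  The underlying graded operad of \<open>Ainf\<close> is free on the \<open>cgen n\<close>: maps of graded operads into
  the underlying graded operad of \<open>Q\<close> are determined by arbitrary images of the generators.
\<close>

definition graded_morphism ::
  "('b, 'k::field) dg_data \<Rightarrow> ('c, 'k) dg_data \<Rightarrow> (('b \<Rightarrow>\<^sub>0 'k) \<Rightarrow> ('c \<Rightarrow>\<^sub>0 'k)) \<Rightarrow> bool" where
  "graded_morphism P Q f \<longleftrightarrow>
     Vector_Spaces.linear scale scale f \<and>
     (\<forall>n d. \<forall>a\<in>homog P n d. f a \<in> homog Q n d) \<and>
     (\<forall>r s i. \<forall>a\<in>aspace P r. \<forall>b\<in>aspace P s. 1 \<le> i \<and> i \<le> r \<longrightarrow>
        f (circ P i a b) = circ Q i (f a) (f b))"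

theorem Ainf_free_existence:
  fixes Q :: "('c, 'k::field) dg_data"
  assumes "dg_operad Q" "\<And>n. 2 \<le> n \<Longrightarrow> q n \<in> homog Q n (int n - 2)"
  shows "\<exists>f. graded_morphism Ainf Q f \<and> (\<forall>n\<ge>2. f (cgen n) = q n)"
proof -
  interpret free_target Q q
    by (simp add: free_target_def free_target_axioms_def assms)
  have evl: "evl x k (replicate n Leaf) = x" for x k n
    by (induction n arbitrary: k) auto
  have "lin ev (circ Ainf i a b) = circ Q i (lin ev a) (lin ev b)"
    if a: "a \<in> aspace Ainf r" and b: "b \<in> aspace Ainf s" and i: "1 \<le> i" "i \<le> r" for a b r s i
  proof (rule linear_eq_on_keys[where v = a])
    fix T assume "T \<in> Poly_Mapping.keys a"
    then have T: "proper T" "T \<noteq> Leaf" "leaves T = r" using a by (auto simp: aspace_def)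
    show "lin ev (circ Ainf i (vec T) b) = circ Q i (lin ev (vec T)) (lin ev b)"
    proof (rule linear_eq_on_keys[where v = b])
      fix S assume "S \<in> Poly_Mapping.keys b"
      then have S: "proper S" "S \<noteq> Leaf" using b by (auto simp: aspace_def)
      show "lin ev (circ Ainf i (vec T) (vec S)) = circ Q i (lin ev (vec T)) (lin ev (vec S))"
        using ev_graft(1)[OF S T(1,2) i(1)] i(2) T(3) by (simp add: tree_circ_def lin_scale)
    next
      show "Vector_Spaces.linear scale scale (\<lambda>b. circ Q i (lin ev (vec T)) (lin ev b))"
        using circ_linear_right by (intro linearI) (auto simp: Vector_Spaces.linear_iff bilin_simps)
    qed (auto intro!: linearI simp: bilin_simps)
  next
    show "Vector_Spaces.linear scale scale (\<lambda>a. circ Q i (lin ev a) (lin ev b))"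
      using circ_linear_left by (intro linearI) (auto simp: Vector_Spaces.linear_iff bilin_simps)
  qed (auto intro!: linearI simp: bilin_simps)
  moreover have "lin ev a \<in> homog Q n d" if "a \<in> homog Ainf n d" for a n d
    by (rule homog_lin) (use homogD[OF that] ev_homog(1) in blast)
  moreover have "lin ev (cgen n) = q n" for n
    by (simp add: cgen_def evl)
  ultimately show ?thesis
    unfolding graded_morphism_def using linear_lin by blast
qed

theorem Ainf_free_uniqueness:
  fixes Q :: "('c, 'k::field) dg_data"
  assumes f: "graded_morphism Ainf Q f" and g: "graded_morphism Ainf Q g"
    and eq: "\<And>n. 2 \<le> n \<Longrightarrow> f (cgen n) = g (cgen n)" and x: "x \<in> aspace Ainf n"
  shows "f x = g x"
proof (rule linear_eq_on_keys[where v = x])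
  show lf: "Vector_Spaces.linear scale scale f" and lg: "Vector_Spaces.linear scale scale g"
    using f g by (simp_all add: graded_morphism_def)
  fix T assume "T \<in> Poly_Mapping.keys x"
  then have "proper T" "T \<noteq> Leaf" using x by (auto simp: aspace_def)
  then show "f (vec T) = g (vec T)"
  proof (induction "size T" arbitrary: T rule: less_induct)
    case less
    from less.prems show ?case
    proof (cases rule: tree_decompose)
      case (corolla n)
      then show ?thesis using eq[of n] by (simp add: cgen_def)
    next
      case (graft T' S i)
      have "(vec T' :: _ \<Rightarrow>\<^sub>0 'k) \<in> aspace Ainf (leaves T')" "(vec S :: _ \<Rightarrow>\<^sub>0 'k) \<in> aspace Ainf (leaves S)"
        using graft by (auto simp: aspace_def)
      then have "f (circ Ainf i (vec T') (vec S)) = g (circ Ainf i (vec T') (vec S))"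
        using f g graft less.hyps[of T'] less.hyps[of S]
        by (simp add: graded_morphism_def del: Ainf_simps(4))
      then show ?thesis
        using lf lg by (simp add: graft(7) Ainf_vec_graft Vector_Spaces.linear_iff del: Ainf_simps)
    qed
  qed
qed


section \<open>The augmentation\<close>

lemma tdeg_ge_0: "proper t \<Longrightarrow> 0 \<le> tdeg t"
  and tdeg_list_ge_0: "\<forall>t\<in>set ts. proper t \<Longrightarrow> 0 \<le> tdeg_list ts"
  by (induction t and ts rule: leaves_leaves_list.induct) auto

lemma Ass_simps [simp]:
  "basis Ass = {2..}" "arity Ass = (\<lambda>n. n)" "deg Ass = (\<lambda>_. 0)"
  "circ Ass i = bilin (\<lambda>r s. vec (r + s - 1))" "bd Ass = (\<lambda>_. 0)"
  by (simp_all add: Ass_def)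

lemma augm_circ:
  fixes a b :: "tree \<Rightarrow>\<^sub>0 'k::field"
  assumes a: "a \<in> aspace Ainf r" and b: "b \<in> aspace Ainf s" and i: "1 \<le> i" "i \<le> r"
  shows "augm (circ Ainf i a b) = circ Ass i (augm a) (augm b)"
proof (rule linear_eq_on_keys[where v = a])
  fix T assume "T \<in> Poly_Mapping.keys a"
  then have T: "proper T" "T \<noteq> Leaf" "leaves T = r" using a by (auto simp: aspace_def)
  show "augm (circ Ainf i (vec T) b) = circ Ass i (augm (vec T)) (augm b)"
  proof (rule linear_eq_on_keys[where v = b])
    fix S assume "S \<in> Poly_Mapping.keys b"
    then have S: "proper S" using b by (auto simp: aspace_def)
    have "0 \<le> tdeg T" "0 \<le> tdeg S" "tdeg (graft i S T) = tdeg T + tdeg S"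
      "leaves (graft i S T) = leaves T + leaves S - 1"
      using tdeg_ge_0 T S tdeg_graft(1)[of i T S] leaves_graft(1)[of i T S] i by auto
    then show "augm (circ Ainf i (vec T) (vec S)) = circ Ass i (augm (vec T)) (augm (vec S))"
      by (auto simp: augm_def tree_circ_def lin_scale ksign_def)
  qed (auto intro!: linearI simp: augm_def bilin_simps)
qed (auto intro!: linearI simp: augm_def bilin_simps)

lemma augm_homog:
  assumes "a \<in> homog Ainf n d" shows "augm a \<in> homog Ass n d"
  unfolding augm_def
proof (rule homog_lin)
  fix t assume "t \<in> Poly_Mapping.keys a"
  then show "(if tdeg t = 0 then vec (leaves t) else 0) \<in> homog Ass n d"
    using homogD[OF assms] leaves_ge_2 by (auto simp: homog_def)
qed

lemma homog_aspace: "a \<in> homog P n d \<Longrightarrow> a \<in> aspace P n"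
  by (auto simp: homog_def aspace_def)

lemma augm_bd_vec:
  "proper T \<Longrightarrow> T \<noteq> Leaf \<Longrightarrow> augm (bd Ainf (vec T)) = (0 :: nat \<Rightarrow>\<^sub>0 'k::field)"
proof (induction "size T" arbitrary: T rule: less_induct)
  case less
  from less.prems show ?case
  proof (cases rule: tree_decompose)
    case (corolla n)
    have "augm (circ Ainf i (cgen r) (cgen s))
        = (if r = 2 \<and> s = 2 then vec 3 else 0 :: nat \<Rightarrow>\<^sub>0 'k)" if "(r, s, i) \<in> cindices n" for r s i
    proof -
      have c: "2 \<le> r" "2 \<le> s" "1 \<le> i" "i \<le> r" using that by (auto simp: cindices_def)
      have "augm (circ Ainf i (cgen r) (cgen s)) = circ Ass i (augm (cgen r)) (augm (cgen s) :: nat \<Rightarrow>\<^sub>0 'k)"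
        by (rule augm_circ[OF cgen_homog[THEN homog_aspace] cgen_homog[THEN homog_aspace]]) (use c in auto)
      then show ?thesis using c by (auto simp: augm_def cgen_def)
    qed
    then have "augm (bd Ainf (cgen n)) = (\<Sum>(r, s, i)\<in>cindices n. scale (ksign (int ((r + i) * s + i)))
        (if r = 2 \<and> s = 2 then vec 3 else 0 :: nat \<Rightarrow>\<^sub>0 'k))"
      unfolding Ainf_bd_cgen by (simp add: augm_def lin_sum lin_scale case_prod_beta del: Ainf_simps)
    also have "\<dots> = 0"
    proof (cases "n = 3")
      case True
      have "(\<Sum>(r, s, i)\<in>cindices n. scale (ksign (int ((r + i) * s + i)))
          (if r = 2 \<and> s = 2 then vec 3 else 0 :: nat \<Rightarrow>\<^sub>0 'k))
        = (\<Sum>(r, s, i)\<in>{(2, 2, 1), (2, 2, 2)}. scale (ksign (int ((r + i) * s + i)))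
          (if r = 2 \<and> s = 2 then vec 3 else 0 :: nat \<Rightarrow>\<^sub>0 'k))"
        by (rule sum.cong) (auto simp: cindices_def True)
      then show ?thesis by (simp add: ksign_def)
    next
      case False
      then show ?thesis by (intro sum.neutral) (auto simp: cindices_def)
    qed
    finally show ?thesis by (simp add: corolla cgen_def)
  next
    case (graft T' S i)
    let ?T = "vec T' :: tree \<Rightarrow>\<^sub>0 'k" and ?S = "vec S :: tree \<Rightarrow>\<^sub>0 'k"
    have h: "?T \<in> homog Ainf (leaves T') (tdeg T')" "?S \<in> homog Ainf (leaves S) (tdeg S)"
      using graft by (auto intro: vec_homog)
    have IH: "augm (bd Ainf ?T) = 0" "augm (bd Ainf ?S) = 0" using less.hyps graft by auto
    have "augm (bd Ainf (circ Ainf i ?T ?S))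
      = augm (circ Ainf i (bd Ainf ?T) ?S) + scale (ksign (tdeg T')) (augm (circ Ainf i ?T (bd Ainf ?S)))"
      unfolding Ainf_bd_circ[OF h(1) graft(5,6)] by (simp add: augm_def lin_add lin_scale)
    also have "augm (circ Ainf i (bd Ainf ?T) ?S) = 0"
      using augm_circ[OF h(1)[THEN Ainf_bd_homog, THEN homog_aspace] h(2)[THEN homog_aspace] graft(5,6)] IH
      by simp
    also have "augm (circ Ainf i ?T (bd Ainf ?S)) = 0"
      using augm_circ[OF h(1)[THEN homog_aspace] h(2)[THEN Ainf_bd_homog, THEN homog_aspace] graft(5,6)] IH
      by simp
    finally have "augm (bd Ainf (circ Ainf i ?T ?S)) = 0" by simp
    then show ?thesis
      by (simp only: graft(7) Ainf_vec_graft Ainf_simps augm_def lin_scale fvs.scale_zero_right)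
  qed
qed

theorem dg_morphism_augm: "dg_morphism (Ainf :: (tree, 'k::field) dg_data) Ass augm"
proof -
  have "augm (bd Ainf a) = bd Ass (augm a)" if "a \<in> homog Ainf n d" for a :: "tree \<Rightarrow>\<^sub>0 'k" and n d
    unfolding Ass_simps
  proof (rule linear_eq_on_keys[where v = a and g = "\<lambda>_. 0"])
    fix T assume "T \<in> Poly_Mapping.keys a"
    then show "augm (bd Ainf (vec T)) = 0" using homogD[OF that] by (intro augm_bd_vec) auto
  qed (auto intro!: linearI simp: augm_def bilin_simps)
  then show ?thesis
    unfolding dg_morphism_def using augm_homog augm_circ linear_lin by (auto simp: augm_def simp del: Ainf_simps Ass_simps)
qed

lemma augm_cgen: "2 \<le> n \<Longrightarrow> augm (cgen n) = (if n = 2 then vec 2 else 0)"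
  by (simp add: augm_def cgen_def)

end

theory Submission
  imports Defs
begin

text \<open>
  Coassociativity already fails on \<open>c(4)\<close>.  Everything happens in the cellular chains of the
  associahedra of dimension at most two: \<open>c(2)\<close> is a point, \<open>c(3)\<close> is an interval whose end points
  are the two binary trees \<open>lcomb\<close> and \<open>rcomb\<close>, and \<open>c(4)\<close> is a pentagon, whose five edges are the
  trees \<open>c(3) \<circ>\<^sub>i c(2)\<close> and \<open>c(2) \<circ>\<^sub>i c(3)\<close>.

  For degree reasons \<open>\<Delta> c(2) = \<alpha> c(2) \<otimes> c(2)\<close>.  A diagonal has \<open>\<alpha> = 1\<close> because of what it does on
  homology, and the counit of a Hopf operad forces \<open>\<alpha> \<noteq> 0\<close>; the latter is enough.  On the interval,
  compatibility with the boundary and coassociativity leave only the two Alexander-Whitney formulas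
  \<open>\<Delta> c(3) = \<alpha>\<^sup>2 (c(3) \<otimes> Y + X \<otimes> c(3))\<close>, one for each of the orientations \<open>X \<rightarrow> Y\<close> of the interval
  (\<open>diag_cor3_cases\<close>).  As \<open>\<Delta>\<close> is a morphism of operads, every edge \<open>e\<close> of the pentagon then
  gets an orientation as well, from a source to a target vertex, with
  \<open>\<Delta> e = \<alpha>\<^sup>3 (e \<otimes> target + source \<otimes> e)\<close>.

  Now let \<open>m(a, b)\<close> denote the coefficients of \<open>\<Delta> c(4)\<close>.  Comparing the coefficients of
  \<open>v \<otimes> e \<otimes> f\<close>, for a vertex \<open>v\<close> and edges \<open>e\<close> and \<open>f\<close>, in the two iterated diagonals of \<open>c(4)\<close> gives
  \<open>m(e, f) \<alpha>\<^sup>3 [v = source e] = m(v, c(4)) m(e, f)\<close>: all edges \<open>e\<close> with a nonzero row \<open>m(e, -)\<close>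
  have the same source, namely the only vertex \<open>v\<close> with \<open>m(v, c(4)) \<noteq> 0\<close> (\<open>unique_edge\<close>).
  On the other hand, if the row of \<open>e\<close> vanishes, then \<open>e \<otimes> v\<close> can occur in the boundary of
  \<open>\<Delta> c(4)\<close> only through \<open>\<partial> c(4) \<otimes> v\<close>, and comparison with \<open>\<Delta> (\<partial> c(4))\<close> gives
  \<open>m(c(4), v) = \<alpha>\<^sup>3 [v = target e]\<close> for every vertex \<open>v\<close> (\<open>boundary_edge\<close>): all edges with zero row
  have the same target.  But the three edges \<open>c(3) \<circ>\<^sub>i c(2)\<close> have three different sources and three
  different targets, for either orientation of the interval; at most one of them can have a nonzero
  row, and at most one of them a zero row.
\<close>

section \<open>Coefficients\<close>

abbreviation coef :: "('b \<Rightarrow>\<^sub>0 'k::zero) \<Rightarrow> 'b \<Rightarrow> 'k" where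
  "coef \<equiv> Poly_Mapping.lookup"

text \<open>
  Every coefficient comparison below has a single contributing basis element, for reasons of degree
  and arity; this lemma and its variants for \<open>tensor_map\<close> and for the differential of a tensor product
  isolate that element.
\<close>

lemma coef_lin_single:
  assumes "\<And>a. a \<in> Poly_Mapping.keys v \<Longrightarrow> a \<noteq> a0 \<Longrightarrow> coef (f a) b = 0"
  shows "coef (lin f v) b = coef v a0 * coef (f a0) b"
proof -
  have "coef (lin f v) b = (\<Sum>a\<in>Poly_Mapping.keys v. coef v a * coef (f a) b)"
    by (simp add: lin_def lookup_sum)
  also have "\<dots> = (\<Sum>a\<in>Poly_Mapping.keys v. if a = a0 then coef v a0 * coef (f a0) b else 0)"
    by (rule sum.cong) (use assms in auto)
  also have "\<dots> = coef v a0 * coef (f a0) b"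
    by (simp add: in_keys_iff)
  finally show ?thesis .
qed

lemma coef_vec: "coef (vec a) b = (if a = b then 1 else 0)"
  by (simp add: lookup_single when_def)

lemma coef_tens: "coef (tens u v) (a, b) = coef u a * coef v b"
proof -
  have r: "coef (lin (\<lambda>b. vec (a', b)) v) (a, b) = (if a' = a then coef v b else 0)" for a'
    by (subst coef_lin_single[where ?a0.0 = b]) (auto simp: coef_vec)
  show ?thesis
    unfolding tens_def bilin_def by (subst coef_lin_single[where ?a0.0 = a]) (auto simp: r)
qed

lemma tens_vec [simp]: "tens (vec a) (vec b) = vec (a, b)"
  by (simp add: tens_def)

lemma tens_zero [simp]: "tens 0 v = 0" "tens u 0 = 0"
  by (simp_all add: tens_def)

lemma coef_tensor_map_left:
  assumes "\<And>x. (x, y) \<in> Poly_Mapping.keys w \<Longrightarrow> x \<noteq> x0 \<Longrightarrow> coef (f (vec x)) p = 0"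
  shows "coef (tensor_map f id w) (p, y) = coef w (x0, y) * coef (f (vec x0)) p"
  unfolding tensor_map_def
  by (subst coef_lin_single[where ?a0.0 = "(x0, y)"])
    (use assms in \<open>fastforce simp: coef_tens coef_vec split: if_splits\<close>)+

lemma coef_tensor_map_right:
  assumes "\<And>x. (y, x) \<in> Poly_Mapping.keys w \<Longrightarrow> x \<noteq> x0 \<Longrightarrow> coef (f (vec x)) p = 0"
  shows "coef (tensor_map id f w) (y, p) = coef w (y, x0) * coef (f (vec x0)) p"
  unfolding tensor_map_def
  by (subst coef_lin_single[where ?a0.0 = "(y, x0)"])
    (use assms in \<open>fastforce simp: coef_tens coef_vec split: if_splits\<close>)+

lemma coef_reassoc: "coef (reassoc v) (a, b, c) = coef v ((a, b), c)"
  unfolding reassoc_def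
  by (subst coef_lin_single[where ?a0.0 = "((a, b), c)"]) (auto simp: coef_vec split: if_splits)

lemma tensor_simps [simp]:
  "basis (P \<otimes>\<^sub>o Q) = {(a, b). a \<in> basis P \<and> b \<in> basis Q \<and> arity P a = arity Q b}"
  "arity (P \<otimes>\<^sub>o Q) = (\<lambda>(a, b). arity P a)"
  "deg (P \<otimes>\<^sub>o Q) = (\<lambda>(a, b). deg P a + deg Q b)"
  "circ (P \<otimes>\<^sub>o Q) i = bilin (\<lambda>(a, b) (a', b').
     scale (ksign (deg Q b * deg P a'))
       (tens (circ P i (vec a) (vec a')) (circ Q i (vec b) (vec b'))))"
  "bd (P \<otimes>\<^sub>o Q) = lin (\<lambda>(a, b).
     tens (bd P (vec a)) (vec b) + scale (ksign (deg P a)) (tens (vec a) (bd Q (vec b))))"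
  by (simp_all add: tensor_def)

text \<open>
  The coefficient of \<open>e \<otimes> v\<close> in a boundary comes from terms \<open>\<partial>x \<otimes> v\<close> and \<open>e \<otimes> \<partial>y\<close>; if \<open>w\<close>
  contains no \<open>e \<otimes> y\<close> at all, only the former remain.
\<close>

lemma coef_bd_tensor:
  assumes row: "\<And>y. coef w (e, y) = 0"
    and unique: "\<And>x. (x, v) \<in> Poly_Mapping.keys w \<Longrightarrow> x \<noteq> x0 \<Longrightarrow> coef (bd P (vec x)) e = 0"
  shows "coef (bd (P \<otimes>\<^sub>o Q) w) (e, v) = coef w (x0, v) * coef (bd P (vec x0)) e"
proof -
  let ?f = "\<lambda>(a, b). tens (bd P (vec a)) (vec b) + scale (ksign (deg P a)) (tens (vec a) (bd Q (vec b)))"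
  have f: "coef (?f (a, b)) (e, v) = (if b = v then coef (bd P (vec a)) e else 0)" if "a \<noteq> e" for a b
    using that by (simp add: lookup_add coef_tens coef_vec)
  have "coef (lin ?f w) (e, v) = coef w (x0, v) * coef (?f (x0, v)) (e, v)"
  proof (rule coef_lin_single)
    fix p assume p: "p \<in> Poly_Mapping.keys w" "p \<noteq> (x0, v)"
    obtain a b where ab: "p = (a, b)" by fastforce
    have "a \<noteq> e" using p row[of b] ab by (auto simp: in_keys_iff)
    then show "coef (?f p) (e, v) = 0" using f[of a b] unique[of a] p ab by auto
  qed
  also have "\<dots> = coef w (x0, v) * coef (bd P (vec x0)) e"
  proof (cases "x0 = e")
    case True
    then show ?thesis using row by simp
  next
    case False
    then show ?thesis using f by simp
  qed
  finally show ?thesis by simp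
qed

lemma vec_neq_0: "(vec b :: _ \<Rightarrow>\<^sub>0 'k::field) \<noteq> 0"
  by (metis insert_not_empty keys_vec keys_zero)

section \<open>Trees with at most four leaves\<close>

abbreviation "cor2 \<equiv> Node [Leaf, Leaf]"
abbreviation "cor3 \<equiv> Node [Leaf, Leaf, Leaf]"
abbreviation "cor4 \<equiv> Node [Leaf, Leaf, Leaf, Leaf]"
abbreviation "lcomb \<equiv> Node [cor2, Leaf]"
abbreviation "rcomb \<equiv> Node [Leaf, cor2]"

lemma node_cases:
  assumes "proper (Node ts)" "leaves (Node ts) \<le> 4"
  obtains a b where "ts = [a, b]" | a b c where "ts = [a, b, c]" | a b c d where "ts = [a, b, c, d]"
proof -
  have "length ts \<in> {2, 3, 4}"
    using assms leaves_list_ge[of ts] by auto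
  then show ?thesis using that by (auto simp: numeral_eq_Suc length_Suc_conv)
qed

lemma leaves_1: "proper t \<Longrightarrow> leaves t = Suc 0 \<longleftrightarrow> t = Leaf"
  using leaves_ge_2[of t] by (cases "t = Leaf") auto

lemma leaves_2:
  assumes "proper t" "leaves t = 2" shows "t = cor2"
proof (cases t)
  case (Node ts)
  have "proper (Node ts)" "leaves (Node ts) \<le> 4" using assms Node by auto
  then show ?thesis
  proof (cases rule: node_cases)
    case (1 a b)
    then have "leaves a = 1 \<and> leaves b = 1"
      using assms Node leaves_ge_1[of a] leaves_ge_1[of b] by simp
    then show ?thesis using 1 assms Node by (auto simp: leaves_1)
  next
    case (2 a b c)
    then show ?thesis
      using assms Node leaves_ge_1[of a] leaves_ge_1[of b] leaves_ge_1[of c] by simp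
  next
    case (3 a b c d)
    then show ?thesis
      using assms Node leaves_ge_1[of a] leaves_ge_1[of b] leaves_ge_1[of c] leaves_ge_1[of d]
      by simp
  qed
qed (use assms in auto)

lemma leaves_3:
  assumes "proper t" "leaves t = 3" shows "t \<in> {cor3, lcomb, rcomb}"
proof (cases t)
  case (Node ts)
  have "proper (Node ts)" "leaves (Node ts) \<le> 4" using assms Node by auto
  then show ?thesis
  proof (cases rule: node_cases)
    case (1 a b)
    then have "leaves a = 1 \<and> leaves b = 2 \<or> leaves a = 2 \<and> leaves b = 1"
      using assms Node leaves_ge_1[of a] leaves_ge_1[of b] by simp linarith
    then show ?thesis using 1 assms Node leaves_2 by (auto simp: leaves_1)
  next
    case (2 a b c)
    then have "leaves a = 1 \<and> leaves b = 1 \<and> leaves c = 1"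
      using assms Node leaves_ge_1[of a] leaves_ge_1[of b] leaves_ge_1[of c] by simp
    then show ?thesis using 2 assms Node by (auto simp: leaves_1)
  next
    case (3 a b c d)
    then show ?thesis
      using assms Node leaves_ge_1[of a] leaves_ge_1[of b] leaves_ge_1[of c] leaves_ge_1[of d]
      by simp
  qed
qed (use assms in auto)

text \<open>
  Trees with four leaves are the faces of the pentagon.  Its vertices, the binary trees, are grouped
  together as the trees of degree zero, which is how they appear in the coefficient comparisons.
\<close>

lemma leaves_4:
  assumes "proper t" "leaves t = 4"
  shows "tdeg t = 0 \<or> t \<in> {graft 1 cor2 cor3, graft 2 cor2 cor3, graft 3 cor2 cor3,
       graft 1 cor3 cor2, graft 2 cor3 cor2} \<or> t = cor4"
proof (cases t)
  case (Node ts)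
  have "proper (Node ts)" "leaves (Node ts) \<le> 4" using assms Node by auto
  then show ?thesis
  proof (cases rule: node_cases)
    case (1 a b)
    then have "leaves a = 1 \<and> leaves b = 3 \<or> leaves a = 2 \<and> leaves b = 2 \<or> leaves a = 3 \<and> leaves b = 1"
      using assms Node leaves_ge_1[of a] leaves_ge_1[of b] by simp linarith
    then show ?thesis
      using 1 assms Node leaves_2[of a] leaves_2[of b] leaves_3[of a] leaves_3[of b]
      by (auto simp: leaves_1)
  next
    case (2 a b c)
    then have "leaves a = 1 \<and> leaves b = 1 \<and> leaves c = 2 \<or> leaves a = 1 \<and> leaves b = 2 \<and> leaves c = 1
        \<or> leaves a = 2 \<and> leaves b = 1 \<and> leaves c = 1"
      using assms Node leaves_ge_1[of a] leaves_ge_1[of b] leaves_ge_1[of c] by simp linarith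
    then show ?thesis using 2 assms Node leaves_2[of a] leaves_2[of b] leaves_2[of c] by (auto simp: leaves_1)
  next
    case (3 a b c d)
    then have "leaves a = 1 \<and> leaves b = 1 \<and> leaves c = 1 \<and> leaves d = 1"
      using assms Node leaves_ge_1[of a] leaves_ge_1[of b] leaves_ge_1[of c] leaves_ge_1[of d]
      by simp
    then show ?thesis using 3 assms Node by (auto simp: leaves_1)
  qed
qed (use assms in auto)

lemma cindices_2: "cindices (Suc (Suc 0)) = {}"
  and cindices_3: "cindices (Suc (Suc (Suc 0))) = {(2, 2, 1), (2, 2, 2)}"
  and cindices_4: "cindices (Suc (Suc (Suc (Suc 0)))) = {(2, 3, 1), (2, 3, 2), (3, 2, 1), (3, 2, 2), (3, 2, 3)}"
  by (auto simp: cindices_def)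

lemma bd_cor3: "bd Ainf (vec cor3) = vec rcomb - vec lcomb"
  by (simp add: node_bd_def cindices_3 face_def ksign_def fvs.scale_minus_left)

text \<open>
  The incidence numbers of three edges of the pentagon.  Their signs are left open because they
  cancel from the equation between \<open>\<partial> (\<Delta> c(4))\<close> and \<open>\<Delta> (\<partial> c(4))\<close>.
\<close>

lemma bd_cor4:
  "i \<in> {1, 2, 3} \<Longrightarrow> coef (bd Ainf (vec cor4) :: tree \<Rightarrow>\<^sub>0 'k::field) (graft i cor2 cor3) \<in> {1, - 1}"
  by (auto simp: node_bd_def cindices_4 face_def ksign_def fvs.scale_minus_left coef_vec lookup_minus lookup_add)

lemma keys_dg_morphism:
  fixes t :: tree
  assumes f: "dg_morphism (Ainf :: (tree, 'k::field) dg_data) (Ainf \<otimes>\<^sub>o Ainf) \<Delta>"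
    and t: "proper t" "t \<noteq> Leaf"
    and ab: "(a, b) \<in> Poly_Mapping.keys (\<Delta> (vec t))"
  shows "proper a \<and> proper b \<and> leaves a = leaves t \<and> leaves b = leaves t \<and> tdeg a + tdeg b = tdeg t"
proof -
  have "\<Delta> (vec t) \<in> homog (Ainf \<otimes>\<^sub>o Ainf) (leaves t) (tdeg t)"
    using f vec_homog[OF t] unfolding dg_morphism_def by blast
  then show ?thesis using ab by (auto simp: homog_def)
qed

lemma cor2_multiple:
  assumes f: "dg_morphism (Ainf :: (tree, 'k::field) dg_data) (Ainf \<otimes>\<^sub>o Ainf) \<Delta>"
  obtains \<alpha> where "\<Delta> (vec cor2) = scale \<alpha> (vec (cor2, cor2))"
proof
  show "\<Delta> (vec cor2) = scale (coef (\<Delta> (vec cor2)) (cor2, cor2)) (vec (cor2, cor2))"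
  proof (rule poly_mapping_eqI)
    fix p :: "tree \<times> tree"
    obtain a b where p: "p = (a, b)" by fastforce
    show "coef (\<Delta> (vec cor2)) p = coef (scale (coef (\<Delta> (vec cor2)) (cor2, cor2)) (vec (cor2, cor2))) p"
    proof (cases "p \<in> Poly_Mapping.keys (\<Delta> (vec cor2))")
      case True
      then have "a = cor2 \<and> b = cor2"
        using keys_dg_morphism[OF f, of cor2 a b] leaves_2 p by auto
      then show ?thesis using p by (simp add: coef_vec)
    next
      case False
      then show ?thesis by (auto simp: in_keys_iff coef_vec)
    qed
  qed
qed

section \<open>Arities two and three\<close>

text \<open>
  The scalar \<open>\<alpha>\<close> is kept general, because a counit normalises it only up to its own value on \<open>c(2)\<close>.
\<close>

locale coassociative_diagonal =
  fixes \<Delta> :: "(tree \<Rightarrow>\<^sub>0 'k::field) \<Rightarrow> (tree \<times> tree \<Rightarrow>\<^sub>0 'k)" and \<alpha> :: 'k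
  assumes morph: "dg_morphism Ainf (Ainf \<otimes>\<^sub>o Ainf) \<Delta>"
    and coass: "coassociative Ainf \<Delta>"
    and diag_cor2: "\<Delta> (vec cor2) = scale \<alpha> (vec (cor2, cor2))"
    and nonzero: "\<alpha> \<noteq> 0"
begin

lemma diag_linear: "Vector_Spaces.linear scale scale \<Delta>"
  using morph by (simp add: dg_morphism_def)

lemma diag_diff: "\<Delta> (u - v) = \<Delta> u - \<Delta> v"
proof -
  interpret Vector_Spaces.linear scale scale \<Delta> by (rule diag_linear)
  show ?thesis by (rule diff)
qed

lemma keys_diag:
  "proper t \<Longrightarrow> t \<noteq> Leaf \<Longrightarrow> (a, b) \<in> Poly_Mapping.keys (\<Delta> (vec t))
   \<Longrightarrow> proper a \<and> proper b \<and> leaves a = leaves t \<and> leaves b = leaves t \<and> tdeg a + tdeg b = tdeg t"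
  by (rule keys_dg_morphism[OF morph])

text \<open>
  The degree condition says that grafting involves no Koszul sign, so that the tree is the composite
  itself.  It holds whenever the result has at most four leaves, since \<open>S\<close> or \<open>T\<close> is then binary.
\<close>

lemma diag_graft:
  assumes "proper T" "T \<noteq> Leaf" "proper S" "S \<noteq> Leaf" "1 \<le> i" "i \<le> leaves T" "tdeg S * after i T = 0"
  shows "\<Delta> (vec (graft i S T)) = circ (Ainf \<otimes>\<^sub>o Ainf) i (\<Delta> (vec T)) (\<Delta> (vec S))"
proof -
  have "(vec (graft i S T) :: tree \<Rightarrow>\<^sub>0 'k) = circ Ainf i (vec T) (vec S)"
    unfolding Ainf_simps bilin_vec tree_circ_def assms(7) by (simp add: ksign_def)
  moreover have "\<Delta> (circ Ainf i (vec T) (vec S)) = circ (Ainf \<otimes>\<^sub>o Ainf) i (\<Delta> (vec T)) (\<Delta> (vec S))"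
    using morph vec_homog[of T, THEN homog_aspace] vec_homog[of S, THEN homog_aspace] assms
    unfolding dg_morphism_def by blast
  ultimately show ?thesis by (simp del: Ainf_simps tensor_simps)
qed

lemma diag_bd: "proper t \<Longrightarrow> t \<noteq> Leaf \<Longrightarrow> \<Delta> (bd Ainf (vec t)) = bd (Ainf \<otimes>\<^sub>o Ainf) (\<Delta> (vec t))"
  using morph vec_homog[of t] unfolding dg_morphism_def by blast

lemma coassociativity_coef:
  assumes "proper t" "t \<noteq> Leaf"
  shows "coef (tensor_map \<Delta> id (\<Delta> (vec t))) ((a, b), c) = coef (tensor_map id \<Delta> (\<Delta> (vec t))) (a, b, c)"
proof -
  have "reassoc (tensor_map \<Delta> id (\<Delta> (vec t))) = tensor_map id \<Delta> (\<Delta> (vec t))"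
    using coass vec_homog[OF assms, THEN homog_aspace] unfolding coassociative_def by blast
  then show ?thesis by (metis coef_reassoc)
qed

lemma diag_lcomb: "\<Delta> (vec lcomb) = scale (\<alpha>\<^sup>2) (vec (lcomb, lcomb))"
  and diag_rcomb: "\<Delta> (vec rcomb) = scale (\<alpha>\<^sup>2) (vec (rcomb, rcomb))"
  using diag_graft[of cor2 cor2 1] diag_graft[of cor2 cor2 2]
  by (simp_all add: diag_cor2 bilin_simps tree_circ_def ksign_def power2_eq_square)

text \<open>
  With \<open>a\<close>, \<open>b\<close>, \<open>c\<close>, \<open>d\<close> the coefficients of \<open>c(3) \<otimes> lcomb\<close>, \<open>c(3) \<otimes> rcomb\<close>, \<open>lcomb \<otimes> c(3)\<close> and
  \<open>rcomb \<otimes> c(3)\<close>, the boundary condition leaves the line \<open>a = d\<close>, \<open>b = c\<close>, \<open>a + b = \<alpha>\<^sup>2\<close> of solutions,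
  and the quadratic coassociativity law forces \<open>a b = 0\<close>, which leaves two points of that line.
\<close>

lemma diag_cor3_cases:
  obtains X Y where "\<Delta> (vec cor3) = scale (\<alpha>\<^sup>2) (vec (cor3, Y) + vec (X, cor3))"
    "(X, Y) \<in> {(lcomb, rcomb), (rcomb, lcomb)}"
proof -
  define a b c d where "a = coef (\<Delta> (vec cor3)) (cor3, lcomb)" and "b = coef (\<Delta> (vec cor3)) (cor3, rcomb)"
     and "c = coef (\<Delta> (vec cor3)) (lcomb, cor3)" and "d = coef (\<Delta> (vec cor3)) (rcomb, cor3)"
  have D: "\<Delta> (vec cor3) = scale a (vec (cor3, lcomb)) + scale b (vec (cor3, rcomb))
     + scale c (vec (lcomb, cor3)) + scale d (vec (rcomb, cor3))" (is "_ = ?D")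
  proof (rule poly_mapping_eqI)
    fix p :: "tree \<times> tree"
    obtain x y where p: "p = (x, y)" by fastforce
    show "coef (\<Delta> (vec cor3)) p = coef ?D p"
    proof (cases "p \<in> Poly_Mapping.keys (\<Delta> (vec cor3))")
      case True
      then have k: "proper x \<and> proper y \<and> leaves x = 3 \<and> leaves y = 3 \<and> tdeg x + tdeg y = 1"
        using keys_diag[of cor3 x y] p by auto
      then have "x \<in> {cor3, lcomb, rcomb}" "y \<in> {cor3, lcomb, rcomb}" using leaves_3 by blast+
      with k have "p \<in> {(cor3, lcomb), (cor3, rcomb), (lcomb, cor3), (rcomb, cor3)}" using p by auto
      then show ?thesis
        by (auto simp: coef_vec lookup_add a_def b_def c_def d_def)
    next
      case False
      then show ?thesis
        by (auto simp: in_keys_iff coef_vec lookup_add a_def b_def c_def d_def)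
    qed
  qed
  have bd: "bd (Ainf \<otimes>\<^sub>o Ainf) ?D = scale (\<alpha>\<^sup>2) (vec (rcomb, rcomb)) - scale (\<alpha>\<^sup>2) (vec (lcomb, lcomb))"
    using diag_bd[of cor3] unfolding D bd_cor3 by (simp add: diag_diff diag_lcomb diag_rcomb)
  have bdc: "coef (bd (Ainf \<otimes>\<^sub>o Ainf) ?D) p
      = coef (scale (\<alpha>\<^sup>2) (vec (rcomb, rcomb)) - scale (\<alpha>\<^sup>2) (vec (lcomb, lcomb))) p" for p
    by (simp only: bd)
  have t0: "tree_bd cor3 = vec rcomb - vec lcomb" "tree_bd lcomb = 0" "tree_bd rcomb = 0"
    using bd_cor3 by (simp_all add: node_bd_def cindices_2 cindices_3 face_def ksign_def fvs.scale_minus_left)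
  have "b + d = \<alpha>\<^sup>2" "a = d" "b = c"
    using bdc[of "(rcomb, rcomb)"] bdc[of "(rcomb, lcomb)"] bdc[of "(lcomb, rcomb)"]
    by (simp_all add: bilin_simps t0 coef_tens coef_vec lookup_add lookup_minus ksign_def del: tree_bd.simps)
  moreover have "a * b = 0"
  proof -
    \<comment> \<open>On the right-hand side of the coassociativity law the coefficient vanishes, since
      \<open>\<Delta>\<close> is diagonal on \<open>lcomb\<close> and \<open>rcomb\<close> and thus does not produce \<open>rcomb \<otimes> lcomb\<close>.\<close>
    have "coef (tensor_map \<Delta> id ?D) ((cor3, rcomb), lcomb) = a * b"
      by (subst coef_tensor_map_left[where ?x0.0 = cor3])
      (auto simp: D coef_vec lookup_add dest!: keys_addD keys_scaleD)
    moreover have "coef (tensor_map id \<Delta> ?D) (cor3, rcomb, lcomb) = 0"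
      by (subst coef_tensor_map_right[where ?x0.0 = rcomb])
      (auto simp: diag_rcomb diag_lcomb coef_vec lookup_add dest!: keys_addD keys_scaleD)
    ultimately show ?thesis using coassociativity_coef[of cor3 cor3 rcomb lcomb] by (simp add: D)
  qed
  ultimately consider "a = 0" "d = 0" "b = \<alpha>\<^sup>2" "c = \<alpha>\<^sup>2" | "b = 0" "c = 0" "a = \<alpha>\<^sup>2" "d = \<alpha>\<^sup>2"
    by auto
  then show thesis
  proof cases
    case 1
    then show thesis using that[of rcomb lcomb] D by (simp add: fvs.scale_right_distrib)
  next
    case 2
    then show thesis using that[of lcomb rcomb] D by (simp add: fvs.scale_right_distrib)
  qed
qed

end

section \<open>Arity four\<close>

text \<open>
  Both orientations of the interval are treated at once: the argument rests on the fact that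
  grafting \<open>c(2)\<close> onto the three leaves of \<open>X\<close>, and likewise of \<open>Y\<close>, yields three different trees.
\<close>

locale oriented_diagonal = coassociative_diagonal \<Delta> \<alpha>
  for \<Delta> :: "(tree \<Rightarrow>\<^sub>0 'k::field) \<Rightarrow> (tree \<times> tree \<Rightarrow>\<^sub>0 'k)" and \<alpha> +
  fixes X Y :: tree
  assumes diag_cor3: "\<Delta> (vec cor3) = scale (\<alpha>\<^sup>2) (vec (cor3, Y) + vec (X, cor3))"
    and XY: "(X, Y) \<in> {(lcomb, rcomb), (rcomb, lcomb)}"
begin

text \<open>
  Three edges of the pentagon with their end points, oriented by \<open>X \<rightarrow> Y\<close>.  The other two edges
  \<open>c(2) \<circ>\<^sub>i c(3)\<close> enter only through \<open>diag_degree_1\<close>.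
\<close>

definition edge where "edge i = graft i cor2 cor3"
definition source where "source i = graft i cor2 X"
definition target where "target i = graft i cor2 Y"

lemma edge_props:
  assumes "i \<in> {1, 2, 3}"
  shows "proper (edge i)" "leaves (edge i) = 4" "tdeg (edge i) = 1"
    "tdeg (source i) = 0" "tdeg (target i) = 0"
  using assms XY by (auto simp: edge_def source_def target_def)

lemma endpoints_distinct:
  "i \<in> {1, 2, 3} \<Longrightarrow> j \<in> {1, 2, 3} \<Longrightarrow> i \<noteq> j \<Longrightarrow> source i \<noteq> source j \<and> target i \<noteq> target j"
  using XY by (auto simp: source_def target_def)

lemma diag_edge:
  assumes "i \<in> {1, 2, 3}"
  shows "\<Delta> (vec (edge i)) = scale (\<alpha> ^ 3) (vec (edge i, target i) + vec (source i, edge i))"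
  unfolding edge_def source_def target_def using assms
  by (subst diag_graft) (auto simp: diag_cor3 diag_cor2 bilin_simps tree_circ_def ksign_def
      power2_eq_square power3_eq_cube mult.assoc)

text \<open>
  Every edge of the pentagon inherits the Alexander-Whitney formula from \<open>c(3)\<close>.  The end points
  themselves matter only for the edges \<open>edge i\<close>; of the others one needs to know that their
  diagonals do not involve \<open>edge i\<close>.
\<close>

lemma diag_degree_1:
  assumes "proper x" "leaves x = 4" "tdeg x = 1"
  obtains s t where "tdeg s = 0" "tdeg t = 0" "\<Delta> (vec x) = scale (\<alpha> ^ 3) (vec (x, t) + vec (s, x))"
proof -
  consider i where "i \<in> {1, 2, 3}" "x = edge i" | i where "i \<in> {1, 2}" "x = graft i cor3 cor2"
    using leaves_4[OF assms(1,2)] assms(3) unfolding edge_def by fastforce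
  then show thesis
  proof cases
    case 1
    then show thesis using that diag_edge edge_props by metis
  next
    case 2
    then have "\<Delta> (vec x) = scale (\<alpha> ^ 3) (vec (x, graft i Y cor2) + vec (graft i X cor2, x))"
      by (subst 2, subst diag_graft) (auto simp: diag_cor3 diag_cor2 bilin_simps tree_circ_def ksign_def
          power2_eq_square power3_eq_cube mult.assoc)
    moreover have "tdeg (graft i X cor2) = 0" "tdeg (graft i Y cor2) = 0" using 2(1) XY by auto
    ultimately show thesis using that by blast
  qed
qed

lemma coef_diag_edge:
  assumes "i \<in> {1, 2, 3}" "tdeg v = 0"
  shows "coef (\<Delta> (vec (edge i))) (v, edge i) = (if v = source i then \<alpha> ^ 3 else 0)"
    and "coef (\<Delta> (vec (edge i))) (edge i, v) = (if v = target i then \<alpha> ^ 3 else 0)"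
  using diag_edge[OF assms(1)] assms edge_props[OF assms(1)]
  by (auto simp: coef_vec lookup_add)

lemma coef_diag_other:
  assumes "proper x" "leaves x = 4" "tdeg x = 1" "x \<noteq> e" "tdeg e = 1" "tdeg v = 0"
  shows "coef (\<Delta> (vec x)) (v, e) = 0" "coef (\<Delta> (vec x)) (e, v) = 0"
proof -
  obtain s t where "tdeg s = 0" "tdeg t = 0" "\<Delta> (vec x) = scale (\<alpha> ^ 3) (vec (x, t) + vec (s, x))"
    using diag_degree_1[OF assms(1-3)] .
  then show "coef (\<Delta> (vec x)) (v, e) = 0" "coef (\<Delta> (vec x)) (e, v) = 0"
    using assms by (auto simp: coef_vec lookup_add)
qed

abbreviation "D \<equiv> \<Delta> (vec cor4)"

lemma keys_diag_cor4:
  "(a, b) \<in> Poly_Mapping.keys D \<Longrightarrow>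
    proper a \<and> proper b \<and> leaves a = 4 \<and> leaves b = 4 \<and> tdeg a + tdeg b = 2"
  using keys_diag[of cor4 a b] by simp

lemma degree_2: "proper x \<Longrightarrow> leaves x = 4 \<Longrightarrow> tdeg x = 2 \<Longrightarrow> x = cor4"
  using leaves_4[of x] by fastforce

text \<open>
  The coefficient of \<open>v \<otimes> edge i \<otimes> y\<close> in the two iterated diagonals of \<open>c(4)\<close>.  On the left it
  comes from terms \<open>x \<otimes> y\<close> of \<open>\<Delta> c(4)\<close> with \<open>x\<close> of degree one, and only \<open>x = edge i\<close> has
  \<open>edge i\<close> in its diagonal; on the right it comes from terms \<open>v \<otimes> x\<close> with \<open>x\<close> of degree two,
  that is from \<open>v \<otimes> c(4)\<close>.
\<close>

lemma coassociativity_edge: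
  assumes i: "i \<in> {1, 2, 3}" and v: "tdeg v = 0" and y: "tdeg y = 1"
  shows "coef D (edge i, y) * coef (\<Delta> (vec (edge i))) (v, edge i) = coef D (v, cor4) * coef D (edge i, y)"
proof -
  have "coef (tensor_map \<Delta> id D) ((v, edge i), y)
      = coef D (edge i, y) * coef (\<Delta> (vec (edge i))) (v, edge i)"
  proof (rule coef_tensor_map_left)
    fix x assume "(x, y) \<in> Poly_Mapping.keys D" "x \<noteq> edge i"
    then show "coef (\<Delta> (vec x)) (v, edge i) = 0"
      using keys_diag_cor4[of x y] edge_props[OF i] v y by (intro coef_diag_other(1)) auto
  qed
  moreover have "coef (tensor_map id \<Delta> D) (v, edge i, y) = coef D (v, cor4) * coef D (edge i, y)"
  proof (rule coef_tensor_map_right)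
    fix x assume "(v, x) \<in> Poly_Mapping.keys D" "x \<noteq> cor4"
    moreover have "x = cor4"
      by (rule degree_2) (use keys_diag_cor4[of v x] calculation v in auto)
    ultimately show "coef (\<Delta> (vec x)) (edge i, y) = 0" by blast
  qed
  moreover have "coef (tensor_map \<Delta> id D) ((v, edge i), y) = coef (tensor_map id \<Delta> D) (v, edge i, y)"
    by (rule coassociativity_coef) simp_all
  ultimately show ?thesis by metis
qed

text \<open>
  By \<open>coassociativity_edge\<close>, a nonzero row at \<open>edge i\<close> determines the coefficient of \<open>v \<otimes> c(4)\<close> for
  every vertex \<open>v\<close>: it is nonzero exactly at \<open>v = source i\<close>.
\<close>

lemma unique_edge:
  assumes ij: "i \<in> {1, 2, 3}" "j \<in> {1, 2, 3}"
    and nz: "coef D (edge i, y) \<noteq> 0" "coef D (edge j, z) \<noteq> 0"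
  shows "i = j"
proof (rule ccontr)
  assume "i \<noteq> j"
  then have ne: "source i \<noteq> source j" using endpoints_distinct ij by blast
  have "tdeg y = 1" "tdeg z = 1"
    using keys_diag_cor4[of "edge i" y] keys_diag_cor4[of "edge j" z] nz edge_props(3) ij by (auto simp: in_keys_iff)
  then have "\<alpha> ^ 3 = coef D (source i, cor4)" "coef D (source i, cor4) = 0"
    using coassociativity_edge[OF ij(1), of "source i" y] coassociativity_edge[OF ij(2), of "source i" z] nz ne
      coef_diag_edge(1)[OF ij(1), of "source i"] coef_diag_edge(1)[OF ij(2), of "source i"]
      edge_props[OF ij(1)] by auto
  then show False using nonzero by simp
qed

lemma diag_lin: "\<Delta> u = lin (\<lambda>t. \<Delta> (vec t)) u"
  by (rule linear_eq_on_keys[OF diag_linear linear_lin]) simp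

text \<open>
  The coefficient of \<open>edge i \<otimes> v\<close> in \<open>\<partial> (\<Delta> c(4)) = \<Delta> (\<partial> c(4))\<close>.  If the row of \<open>edge i\<close> is zero,
  both sides are multiples of the incidence number of \<open>edge i\<close> in \<open>\<partial> c(4)\<close>, which cancels.
\<close>

lemma boundary_edge:
  assumes i: "i \<in> {1, 2, 3}" and v: "tdeg v = 0" and row: "\<And>y. coef D (edge i, y) = 0"
  shows "coef D (cor4, v) = (if v = target i then \<alpha> ^ 3 else 0)"
proof -
  let ?c = "coef (bd Ainf (vec cor4)) (edge i) :: 'k"
  have c: "?c \<noteq> 0" using bd_cor4[OF i, where 'k = 'k] by (auto simp: edge_def simp del: Ainf_simps)
  have "coef D (cor4, v) * ?c = coef (bd (Ainf \<otimes>\<^sub>o Ainf) D) (edge i, v)"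
  proof (rule coef_bd_tensor[symmetric, OF row])
    fix x assume k: "(x, v) \<in> Poly_Mapping.keys D" and "x \<noteq> cor4"
    moreover have "x = cor4"
      by (rule degree_2) (use keys_diag_cor4[OF k] v in auto)
    ultimately show "coef (bd Ainf (vec x :: tree \<Rightarrow>\<^sub>0 'k)) (edge i) = 0" by blast
  qed
  also have "bd (Ainf \<otimes>\<^sub>o Ainf) D = \<Delta> (bd Ainf (vec cor4))"
    by (rule diag_bd[symmetric]) simp_all
  also have "coef \<dots> (edge i, v) = coef (lin (\<lambda>t. \<Delta> (vec t)) (bd Ainf (vec cor4))) (edge i, v)"
    by (simp only: diag_lin[symmetric])
  also have "\<dots> = ?c * coef (\<Delta> (vec (edge i))) (edge i, v)"
  proof (rule coef_lin_single)
    fix x assume x: "x \<in> Poly_Mapping.keys (bd Ainf (vec cor4 :: tree \<Rightarrow>\<^sub>0 'k))" and ne: "x \<noteq> edge i"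
    have "(vec cor4 :: tree \<Rightarrow>\<^sub>0 'k) \<in> homog Ainf 4 2" by (simp add: homog_def)
    then have "bd Ainf (vec cor4 :: tree \<Rightarrow>\<^sub>0 'k) \<in> homog Ainf 4 (2 - 1)" by (rule Ainf_bd_homog)
    then have "proper x \<and> x \<noteq> Leaf \<and> leaves x = 4 \<and> tdeg x = 2 - 1" using x by (rule homogD)
    then show "coef (\<Delta> (vec x)) (edge i, v) = 0"
      using ne v edge_props(3)[OF i] by (intro coef_diag_other(2)) auto
  qed
  finally show ?thesis using c coef_diag_edge(2)[OF i v] by auto
qed

lemma inconsistent: False
proof -
  \<comment> \<open>\<open>R i\<close>: the row of \<open>edge i\<close> is nonzero.\<close>
  define R where "R i \<longleftrightarrow> (\<exists>y. coef D (edge i, y) \<noteq> 0)" for i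
  have unique: "i = j" if "i \<in> {1, 2, 3}" "j \<in> {1, 2, 3}" "R i" "R j" for i j
    using that unfolding R_def by (blast intro: unique_edge)
  have clash: False if ij: "i \<in> {1, 2, 3}" "j \<in> {1, 2, 3}" "i \<noteq> j" and R: "\<not> R i" "\<not> R j" for i j
  proof -
    have "tdeg (target i) = 0" "target i \<noteq> target j"
      using edge_props(5)[OF ij(1)] endpoints_distinct[OF ij] by blast+
    moreover have "coef D (edge i, y) = 0" "coef D (edge j, y) = 0" for y
      using R unfolding R_def by blast+
    ultimately have "\<alpha> ^ 3 = 0"
      using boundary_edge[OF ij(1), of "target i"] boundary_edge[OF ij(2), of "target i"] by metis
    then show False using nonzero by simp
  qed
  have "\<not> (R 1 \<and> R 2)" "\<not> (R 1 \<and> R 3)" "\<not> (R 2 \<and> R 3)"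
    using unique[of 1 2] unique[of 1 3] unique[of 2 3] by auto
  moreover have "R 1 \<or> R 2" "R 1 \<or> R 3" "R 2 \<or> R 3"
    using clash[of 1 2] clash[of 1 3] clash[of 2 3] by auto
  ultimately show False by blast
qed

end

section \<open>Non-vanishing on \<open>c(2)\<close>\<close>

lemma homog_trivial:
  assumes "\<And>b. b \<in> basis P \<Longrightarrow> arity P b = n \<Longrightarrow> deg P b \<noteq> d"
  shows "homog P n d = {0}"
proof -
  have "v = 0" if "v \<in> homog P n d" for v
  proof -
    have "Poly_Mapping.keys v = {}" using that assms unfolding homog_def by blast
    then show ?thesis by simp
  qed
  then show ?thesis by (auto simp: homog_def)
qed

lemma homologous_refl:
  assumes "x \<in> cycles P n d" "bd P 0 = 0"
  shows "(x, x) \<in> homologous P n d"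
proof -
  have "0 \<in> bd P ` homog P n (d + 1)" using assms(2) by (intro image_eqI[of _ _ 0]) (auto simp: homog_def)
  then show ?thesis using assms(1) by (simp add: homologous_def)
qed

text \<open>
  There is nothing of degree one in arity two, so the class of \<open>c(2)\<close> is just \<open>c(2)\<close> itself, and a zero
  value of \<open>\<Delta>\<close> there would give the zero class, whereas \<open>\<mu>\<^sub>2 \<otimes> \<mu>\<^sub>2\<close> is not a boundary.
\<close>

lemma diagonal_nonzero:
  fixes \<Delta> :: "(tree \<Rightarrow>\<^sub>0 'k::field) \<Rightarrow> (tree \<times> tree \<Rightarrow>\<^sub>0 'k)"
  assumes ind: "induces_Ass_diag \<Delta>"
  shows "\<Delta> (vec cor2) \<noteq> 0"
proof
  assume 0: "\<Delta> (vec cor2) = 0"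
  let ?c = "vec cor2 :: tree \<Rightarrow>\<^sub>0 'k"
  have h1: "homog Ainf 2 1 = {0 :: tree \<Rightarrow>\<^sub>0 'k}"
    by (rule homog_trivial) (auto dest: leaves_2)
  have h2: "homog (Ainf \<otimes>\<^sub>o Ainf) 2 1 = {0 :: tree \<times> tree \<Rightarrow>\<^sub>0 'k}"
  proof (rule homog_trivial)
    fix p
    assume "p \<in> basis (Ainf \<otimes>\<^sub>o Ainf :: (tree \<times> tree, 'k) dg_data)"
      "arity (Ainf \<otimes>\<^sub>o Ainf :: (tree \<times> tree, 'k) dg_data) p = 2"
    then have "p = (cor2, cor2)" using leaves_2 by (cases p) auto
    then show "deg (Ainf \<otimes>\<^sub>o Ainf :: (tree \<times> tree, 'k) dg_data) p \<noteq> 1" by simp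
  qed
  have cyc: "?c \<in> cycles Ainf 2 0" by (simp add: cycles_def homog_def node_bd_def cindices_2)
  have "homologous Ainf 2 0 `` {?c} = {?c}"
    using cyc by (auto simp: homologous_def h1)
  then have X: "{?c} \<in> homology Ainf 2 0" using cyc by (auto simp: homology_def quotient_def)
  have l: "homology_map (Ass \<otimes>\<^sub>o Ass) (tensor_map augm augm) 2 0
          (homology_map (Ainf \<otimes>\<^sub>o Ainf) \<Delta> 2 0 {?c}) \<subseteq> {0}"
    by (auto simp: homology_map_def homologous_def h2 0 tensor_map_def split_def)
  have r: "vec (2, 2) \<in> homology_map (Ass \<otimes>\<^sub>o Ass) Ass_diag 2 0
      (homology_map Ass (augm :: _ \<Rightarrow> (nat \<Rightarrow>\<^sub>0 'k)) 2 0 {?c})"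
  proof -
    have "vec 2 \<in> homology_map Ass (augm :: _ \<Rightarrow> (nat \<Rightarrow>\<^sub>0 'k)) 2 0 {?c}"
      unfolding homology_map_def
      by (rule ImageI[OF homologous_refl]) (auto simp: cycles_def homog_def augm_def numeral_2_eq_2)
    moreover have "Ass_diag (vec 2) = (vec (2, 2) :: _ \<Rightarrow>\<^sub>0 'k)" by (simp add: Ass_diag_def)
    ultimately show ?thesis
      unfolding homology_map_def
      by (intro ImageI[OF homologous_refl]) (auto simp: cycles_def homog_def intro!: image_eqI[of _ _ "vec 2"])
  qed
  have "homology_map (Ass \<otimes>\<^sub>o Ass) (tensor_map augm augm) 2 0
          (homology_map (Ainf \<otimes>\<^sub>o Ainf) \<Delta> 2 0 {?c})
      = homology_map (Ass \<otimes>\<^sub>o Ass) Ass_diag 2 0 (homology_map Ass augm 2 0 {?c})"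
    using ind X unfolding induces_Ass_diag_def by blast
  then have "vec (2, 2) = (0 :: nat \<times> nat \<Rightarrow>\<^sub>0 'k)" using l r by blast
  then show False by (simp add: vec_neq_0)
qed

lemma counital_nonzero:
  assumes "counital Ainf \<Delta> \<epsilon>"
  shows "\<Delta> (vec cor2) \<noteq> (0 :: tree \<times> tree \<Rightarrow>\<^sub>0 'k::field)"
proof
  assume 0: "\<Delta> (vec cor2) = 0"
  have "lin (\<lambda>(m, b). vec b) (tensor_map \<epsilon> id (\<Delta> (vec cor2))) = (vec cor2 :: tree \<Rightarrow>\<^sub>0 'k)"
    using assms vec_homog[of cor2, THEN homog_aspace] unfolding counital_def by auto
  then have "vec cor2 = (0 :: tree \<Rightarrow>\<^sub>0 'k)" by (simp add: 0 tensor_map_def)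
  then show False by (simp add: vec_neq_0)
qed

section \<open>Non-existence\<close>

lemma no_coassociative_morphism:
  fixes \<Delta> :: "(tree \<Rightarrow>\<^sub>0 'k::field) \<Rightarrow> (tree \<times> tree \<Rightarrow>\<^sub>0 'k)"
  assumes "dg_morphism Ainf (Ainf \<otimes>\<^sub>o Ainf) \<Delta>" "\<Delta> (vec cor2) \<noteq> 0"
  shows "\<not> coassociative Ainf \<Delta>"
proof
  assume "coassociative Ainf \<Delta>"
  obtain \<alpha> where \<alpha>: "\<Delta> (vec cor2) = scale \<alpha> (vec (cor2, cor2))"
    using cor2_multiple[OF assms(1)] .
  then interpret coassociative_diagonal \<Delta> \<alpha>
    using assms \<open>coassociative Ainf \<Delta>\<close> by unfold_locales auto
  obtain X Y where XY: "\<Delta> (vec cor3) = scale (\<alpha>\<^sup>2) (vec (cor3, Y) + vec (X, cor3))"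
    "(X, Y) \<in> {(lcomb, rcomb), (rcomb, lcomb)}"
    by (rule diag_cor3_cases)
  then interpret oriented_diagonal \<Delta> \<alpha> X Y
    by unfold_locales
  show False by (rule inconsistent)
qed

theorem theorem13:
  shows "\<not> (\<exists>\<Delta> :: (tree \<Rightarrow>\<^sub>0 'k::field) \<Rightarrow> (tree \<times> tree \<Rightarrow>\<^sub>0 'k).
            diagonal \<Delta> \<and> coassociative Ainf \<Delta>)
         \<and> \<not> hopf_operad (Ainf :: (tree, 'k) dg_data)"
proof (intro conjI notI)
  assume "\<exists>\<Delta> :: (tree \<Rightarrow>\<^sub>0 'k) \<Rightarrow> (tree \<times> tree \<Rightarrow>\<^sub>0 'k). diagonal \<Delta> \<and> coassociative Ainf \<Delta>"
  then show False
    using no_coassociative_morphism diagonal_nonzero unfolding diagonal_def by blast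
next
  assume "hopf_operad (Ainf :: (tree, 'k) dg_data)"
  then show False
    using no_coassociative_morphism counital_nonzero unfolding hopf_operad_def by blast
qed

end
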